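(* For all positive integers $n,p$, $$\Omega\left(\mathtt{DP}(n,p)\right)\le \mathtt{SPO}(n,p)\le O\left(\mathtt{DP}(n,p)\log n\right).$$
   Context: For a directed graph $G=(V,E,w)$ with nonnegative real edge weights and a set $P\subseteq V\times V$ of demand pairs, a distance preserver is a subgraph $H\subseteq G$ with $\mathrm{dist}_H(s,t)=\mathrm{dist}_G(s,t)$ for all $(s,t)\in P$; $\mathtt{DP}(n,p)$ is the least integer such that every $n$-node such graph and every set of $|P|=p$ demand pairs has a distance preserver on at most $\mathtt{DP}(n,p)$ edges. A shortest path oracle for $G,P$ is a data structure (a bit string, together with a fixed decoding procedure) that, when queried with any $(s,t)\in P$, reports a shortest $s\leadsto t$ path in $G$ (or "no path" if none exists). $\mathtt{SPO}(n,p)$ is the smallest integer such that every $n$-node graph and set of $|P|=p$ demand pairs has a shortest path oracle on at most $\mathtt{SPO}(n,p)$ bits. *)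

theory Defs
  imports Complex_Main "HOL-Library.Extended_Real"
begin

text \<open>A weighted directed graph on the vertex set {0..<n} is given by an edge set
  E of ordered pairs and a weight function w (only its values on E matter).\<close>

definition wgraph :: "nat \<Rightarrow> (nat \<times> nat) set \<Rightarrow> (nat \<times> nat \<Rightarrow> real) \<Rightarrow> bool" where
  "wgraph n E w \<longleftrightarrow> E \<subseteq> {0..<n} \<times> {0..<n} \<and> (\<forall>e\<in>E. 0 \<le> w e)"

definition is_path :: "(nat \<times> nat) set \<Rightarrow> nat \<Rightarrow> nat \<Rightarrow> nat list \<Rightarrow> bool" where
  "is_path E s t \<pi> \<longleftrightarrow> \<pi> \<noteq> [] \<and> hd \<pi> = s \<and> last \<pi> = t \<and>
     (\<forall>i. Suc i < length \<pi> \<longrightarrow> (\<pi> ! i, \<pi> ! Suc i) \<in> E)"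

definition path_weight :: "(nat \<times> nat \<Rightarrow> real) \<Rightarrow> nat list \<Rightarrow> real" where
  "path_weight w \<pi> = (\<Sum>i<length \<pi> - 1. w (\<pi> ! i, \<pi> ! Suc i))"

text \<open>Distance (infinity if there is no path).\<close>

definition gdist :: "(nat \<times> nat) set \<Rightarrow> (nat \<times> nat \<Rightarrow> real) \<Rightarrow> nat \<Rightarrow> nat \<Rightarrow> ereal" where
  "gdist E w s t = (INF \<pi> \<in> {\<pi>. is_path E s t \<pi>}. ereal (path_weight w \<pi>))"

definition dist_preserver ::
  "(nat \<times> nat) set \<Rightarrow> (nat \<times> nat \<Rightarrow> real) \<Rightarrow> (nat \<times> nat) set \<Rightarrow> (nat \<times> nat) set \<Rightarrow> bool" where
  "dist_preserver E w P H \<longleftrightarrow> H \<subseteq> E \<and> (\<forall>(s,t)\<in>P. gdist H w s t = gdist E w s t)"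

definition DP :: "nat \<Rightarrow> nat \<Rightarrow> nat" where
  "DP n p = (LEAST k. \<forall>E w P. wgraph n E w \<and> P \<subseteq> {0..<n} \<times> {0..<n} \<and> card P = p \<longrightarrow>
       (\<exists>H. dist_preserver E w P H \<and> card H \<le> k))"

definition is_spo ::
  "(bool list \<Rightarrow> nat \<times> nat \<Rightarrow> nat list option) \<Rightarrow> bool list \<Rightarrow>
   (nat \<times> nat) set \<Rightarrow> (nat \<times> nat \<Rightarrow> real) \<Rightarrow> (nat \<times> nat) set \<Rightarrow> bool" where
  "is_spo D b E w P \<longleftrightarrow> (\<forall>(s,t)\<in>P.
     (case D b (s,t) of
        None \<Rightarrow> \<not> (\<exists>\<pi>. is_path E s t \<pi>)
      | Some \<pi> \<Rightarrow> is_path E s t \<pi> \<and> ereal (path_weight w \<pi>) = gdist E w s t))"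

definition SPO :: "nat \<Rightarrow> nat \<Rightarrow> nat" where
  "SPO n p = (LEAST k. \<exists>D. \<forall>E w P. wgraph n E w \<and> P \<subseteq> {0..<n} \<times> {0..<n} \<and> card P = p \<longrightarrow>
       (\<exists>b. length b \<le> k \<and> is_spo D b E w P))"

end

theory Submission
  imports Defs "HOL-Library.Nat_Bijection"
begin

text \<open>
  Lower bound. Let \<open>H\<close> be a smallest preserver of an extremal instance, so that every edge of \<open>H\<close> is
  needed by some demand pair, and let \<open>F\<close> be a directed cut of \<open>H\<close> with at least a quarter of its edges.
  For every \<open>X \<subseteq> F\<close> there is an instance in which the edges of \<open>X\<close> are still forced while the other edges
  of \<open>F\<close> are bypassed: replace \<open>H - X\<close> by all its shortcuts, except for those joining the ends of an edge
  of \<open>F\<close>. Since \<open>F\<close> goes from \<open>A\<close> to its complement, the part of a walk before the first, between two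
  consecutive, or after the last edge of \<open>X\<close> never needs such a forbidden shortcut. An oracle therefore
  distinguishes \<open>2 ^ card F\<close> instances.

  Upper bound. Storing a preserver does not suffice, because the decoder does not know the weights.
  Instead, after a perturbation that makes shortest paths unique, the demand paths are compressed in the
  style of Lempel and Ziv: each path is cut greedily into phrases, a phrase being a longest segment of
  an earlier path followed by one further edge. A phrase takes \<open>O(log n)\<close> bits. Joining the ends of each
  phrase by an edge whose weight is their distance plus a tiny constant gives a graph on the same vertices
  in which the greedy parsing of each path is its unique cheapest tiling. All these edges are
  forced, so that the number of phrases is at most \<open>DP n p + p\<close>.
\<close>

section \<open>Walks and their weights\<close>

text \<open>Listing the edges turns the index-based \<open>is_path\<close> and
  \<open>path_weight\<close> into statements about one list, suited to concatenation and
  recursion.\<close>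

fun path_edges :: "'a list \<Rightarrow> ('a \<times> 'a) list" where
  "path_edges (x # y # xs) = (x, y) # path_edges (y # xs)"
| "path_edges _ = []"

lemma path_edges_conv_nth:
  "path_edges \<pi> = map (\<lambda>i. (\<pi> ! i, \<pi> ! Suc i)) [0..<length \<pi> - 1]"
proof (induction \<pi> rule: path_edges.induct)
  case (1 x y xs)
  have "[0..<Suc (length xs)] = 0 # map Suc [0..<length xs]"
    by (metis map_Suc_upt upt_conv_Cons zero_less_Suc)
  then show ?case using 1 by simp
qed auto

lemma is_path_iff:
  "is_path E s t \<pi> \<longleftrightarrow> \<pi> \<noteq> [] \<and> hd \<pi> = s \<and> last \<pi> = t \<and> set (path_edges \<pi>) \<subseteq> E"
proof -
  have "(\<forall>i. Suc i < length \<pi> \<longrightarrow> (\<pi> ! i, \<pi> ! Suc i) \<in> E) \<longleftrightarrow> set (path_edges \<pi>) \<subseteq> E"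
    unfolding path_edges_conv_nth by (auto simp: image_subset_iff less_diff_conv)
  then show ?thesis unfolding is_path_def by simp
qed

lemma path_weight_eq: "path_weight w \<pi> = sum_list (map w (path_edges \<pi>))"
  unfolding path_weight_def path_edges_conv_nth
  by (simp add: sum_list_sum_nth lessThan_atLeast0)

lemma path_edges_append:
  "\<alpha> \<noteq> [] \<Longrightarrow> path_edges (\<alpha> @ \<beta>) = path_edges \<alpha> @ path_edges (last \<alpha> # \<beta>)"
proof (induction \<alpha> rule: path_edges.induct)
  case (1 x y xs)
  then show ?case by simp
qed auto

lemma set_path_edges_subset: "set (path_edges \<pi>) \<subseteq> set \<pi> \<times> set \<pi>"
  by (induction \<pi> rule: path_edges.induct) auto

lemma path_weight_single [simp]: "path_weight w [x] = 0"
  by (simp add: path_weight_eq)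

lemma path_weight_Cons_Cons [simp]:
  "path_weight w (x # y # xs) = w (x, y) + path_weight w (y # xs)"
  by (simp add: path_weight_eq)

lemma is_path_single [simp]: "is_path E s t [x] \<longleftrightarrow> x = s \<and> x = t"
  by (auto simp: is_path_iff)

lemma is_path_Cons_Cons [simp]:
  "is_path E s t (x # y # xs) \<longleftrightarrow> x = s \<and> (x, y) \<in> E \<and> is_path E y t (y # xs)"
  by (auto simp: is_path_iff)

lemma not_is_path_Nil [simp]: "\<not> is_path E s t []"
  by (simp add: is_path_iff)

lemma is_path_mono: "is_path E s t \<pi> \<Longrightarrow> E \<subseteq> E' \<Longrightarrow> is_path E' s t \<pi>"
  by (auto simp: is_path_iff)

text \<open>\<open>tl\<close> drops the vertex that the two walks share.\<close>

lemma path_edges_join: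
  assumes "is_path E x y \<alpha>" "is_path E' y z \<beta>"
  shows "path_edges (\<alpha> @ tl \<beta>) = path_edges \<alpha> @ path_edges \<beta>"
  using assms path_edges_append[of \<alpha> "tl \<beta>"] by (cases \<beta>) (auto simp: is_path_iff)

lemma is_path_join:
  assumes "is_path E x y \<alpha>" "is_path E y z \<beta>"
  shows "is_path E x z (\<alpha> @ tl \<beta>)"
  using assms path_edges_join[OF assms]
  by (cases \<beta>) (auto simp: is_path_iff last_append)

lemma path_weight_join:
  assumes "is_path E x y \<alpha>" "is_path E' y z \<beta>"
  shows "path_weight w (\<alpha> @ tl \<beta>) = path_weight w \<alpha> + path_weight w \<beta>"
  using path_edges_join[OF assms] by (simp add: path_weight_eq)

lemma is_path_take:
  assumes "is_path E s t \<pi>" "i < length \<pi>"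
  shows "is_path E s (\<pi> ! i) (take (Suc i) \<pi>)"
proof -
  have "last (take (Suc i) \<pi>) = \<pi> ! i" using assms(2) by (simp add: take_Suc_conv_app_nth)
  then show ?thesis using assms unfolding is_path_def by (auto simp: hd_conv_nth)
qed

lemma is_path_drop:
  assumes "is_path E s t \<pi>" "i < length \<pi>"
  shows "is_path E (\<pi> ! i) t (drop i \<pi>)"
  using assms unfolding is_path_def
  by (auto simp: hd_drop_conv_nth)

lemma take_drop_join: "i < length \<pi> \<Longrightarrow> take (Suc i) \<pi> @ tl (drop i \<pi>) = \<pi>"
  by (metis append_take_drop_id drop_Suc tl_drop)

lemma path_weight_take_drop:
  assumes "is_path E s t \<pi>" "i < length \<pi>"
  shows "path_weight w \<pi> = path_weight w (take (Suc i) \<pi>) + path_weight w (drop i \<pi>)"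
  using path_weight_join[OF is_path_take[OF assms] is_path_drop[OF assms], of w]
    take_drop_join[OF assms(2)] by simp

lemma path_weight_nonneg:
  assumes "is_path E s t \<pi>" "\<And>e. e \<in> E \<Longrightarrow> 0 \<le> w e"
  shows "0 \<le> path_weight w \<pi>"
  using assms unfolding path_weight_eq is_path_iff
  by (intro sum_list_nonneg) auto

lemma is_path_set:
  assumes "is_path E s t \<pi>" "E \<subseteq> V \<times> V" "s \<in> V"
  shows "set \<pi> \<subseteq> V"
  using assms by (induction \<pi> arbitrary: s rule: path_edges.induct) auto

lemma is_path_ends:
  assumes "is_path E s t \<pi>"
  shows "s \<in> set \<pi>" "t \<in> set \<pi>" "\<pi> ! 0 = s" "\<pi> ! (length \<pi> - 1) = t" "0 < length \<pi>"
  using assms by (auto simp: is_path_iff hd_conv_nth last_conv_nth)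

text \<open>Cuts out a closed walk at a repeated vertex. The removed walk is returned as well: one
  application needs its weight to be nonnegative, another needs it positive.\<close>

lemma is_path_shortcut:
  assumes "is_path E s t \<pi>" "\<not> distinct \<pi>"
  obtains \<pi>' y ys where "is_path E s t \<pi>'" "length \<pi>' < length \<pi>"
    "is_path E y y (y # ys @ [y])"
    "\<And>w. path_weight w \<pi> = path_weight w \<pi>' + path_weight w (y # ys @ [y])"
proof -
  obtain xs ys zs y where \<pi>: "\<pi> = xs @ [y] @ ys @ [y] @ zs"
    using not_distinct_decomp[OF assms(2)] by blast
  have e: "path_edges \<pi> = path_edges (xs @ [y]) @ path_edges (y # ys @ [y]) @ path_edges (y # zs)"
    using path_edges_append[of "xs @ [y]" "ys @ [y] @ zs"]
      path_edges_append[of "y # ys @ [y]" "zs"] \<pi> by simp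
  have e': "path_edges (xs @ [y] @ zs) = path_edges (xs @ [y]) @ path_edges (y # zs)"
    using path_edges_append[of "xs @ [y]" zs] by simp
  show thesis
  proof
    show "is_path E s t (xs @ [y] @ zs)"
      using assms(1) e e' \<pi> by (auto simp: is_path_iff hd_append last_append)
    show "length (xs @ [y] @ zs) < length \<pi>" using \<pi> by simp
    show "is_path E y y (y # ys @ [y])"
      using assms(1) e by (auto simp: is_path_iff)
    show "path_weight w \<pi> = path_weight w (xs @ [y] @ zs) + path_weight w (y # ys @ [y])" for w
      using e e' by (simp add: path_weight_eq)
  qed
qed

lemma is_path_imp_distinct_path:
  assumes "is_path E s t \<pi>" "\<And>e. e \<in> E \<Longrightarrow> 0 \<le> w e"
  shows "\<exists>\<pi>'. is_path E s t \<pi>' \<and> distinct \<pi>' \<and> path_weight w \<pi>' \<le> path_weight w \<pi>"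
  using assms(1)
proof (induction \<pi> rule: length_induct)
  case (1 \<pi>)
  show ?case
  proof (cases "distinct \<pi>")
    case False
    from is_path_shortcut[OF "1.prems" False] obtain \<pi>' y ys where
      *: "is_path E s t \<pi>'" "length \<pi>' < length \<pi>" "is_path E y y (y # ys @ [y])"
      "\<And>w. path_weight w \<pi> = path_weight w \<pi>' + path_weight w (y # ys @ [y])" by metis
    have "0 \<le> path_weight w (y # ys @ [y])" using path_weight_nonneg[OF *(3)] assms(2) by blast
    then show ?thesis using "1.IH" * by (smt (verit))
  qed (use 1 in auto)
qed

section \<open>Shortest walks\<close>

definition shortest :: "(nat \<times> nat) set \<Rightarrow> (nat \<times> nat \<Rightarrow> real) \<Rightarrow> nat \<Rightarrow> nat \<Rightarrow> nat list \<Rightarrow> bool" where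
  "shortest E w s t \<pi> \<longleftrightarrow>
     is_path E s t \<pi> \<and> (\<forall>\<rho>. is_path E s t \<rho> \<longrightarrow> path_weight w \<pi> \<le> path_weight w \<rho>)"

lemma gdist_le: "is_path E s t \<pi> \<Longrightarrow> gdist E w s t \<le> ereal (path_weight w \<pi>)"
  unfolding gdist_def by (intro INF_lower) simp

lemma gdist_ge: "(\<And>\<pi>. is_path E s t \<pi> \<Longrightarrow> c \<le> ereal (path_weight w \<pi>)) \<Longrightarrow> c \<le> gdist E w s t"
  unfolding gdist_def by (intro INF_greatest) simp

lemma shortest_iff_gdist:
  "shortest E w s t \<pi> \<longleftrightarrow> is_path E s t \<pi> \<and> ereal (path_weight w \<pi>) = gdist E w s t"
  unfolding shortest_def
  by (metis antisym ereal_less_eq(3) gdist_ge gdist_le)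

text \<open>The infimum over infinitely many walks is attained, since walks without repeated
  vertices suffice and there are only finitely many of them.\<close>

lemma shortest_exists:
  assumes "is_path E s t \<pi>" "wgraph n E w" "s < n"
  shows "\<exists>\<pi>. shortest E w s t \<pi> \<and> distinct \<pi>"
proof -
  let ?S = "{\<pi>. set \<pi> \<subseteq> {0..<n} \<and> distinct \<pi>} \<inter> {\<pi>. is_path E s t \<pi>}"
  have E: "E \<subseteq> {0..<n} \<times> {0..<n}" "\<And>e. e \<in> E \<Longrightarrow> 0 \<le> w e"
    using assms(2) by (auto simp: wgraph_def)
  have fin: "finite ?S" using finite_subset_distinct[of "{0..<n}"] by blast
  have *: "\<exists>\<pi>'\<in>?S. path_weight w \<pi>' \<le> path_weight w \<rho>" if "is_path E s t \<rho>" for \<rho>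
    using is_path_imp_distinct_path[OF that, of w] E is_path_set[OF _ E(1), of s t] assms(3) by fastforce
  then have ne: "?S \<noteq> {}" using assms(1) by blast
  define \<pi> where "\<pi> = arg_min_on (path_weight w) ?S"
  have "\<pi> \<in> ?S" using arg_min_if_finite(1)[OF fin ne] \<pi>_def by blast
  moreover have "\<forall>\<rho>\<in>?S. path_weight w \<pi> \<le> path_weight w \<rho>"
    using arg_min_least[OF fin ne] \<pi>_def by blast
  ultimately show ?thesis using * unfolding shortest_def by (metis (mono_tags, lifting) IntE mem_Collect_eq order_trans)
qed

section \<open>The lower bound\<close>

lemma gdist_mono: "E \<subseteq> E' \<Longrightarrow> gdist E' w s t \<le> gdist E w s t"
  by (intro gdist_ge gdist_le) (rule is_path_mono)

text \<open>A walk without repeated vertices uses no loop.\<close>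

lemma is_path_remove_loop:
  assumes "is_path E s t \<pi>" "\<And>e. e \<in> E \<Longrightarrow> 0 \<le> w e"
  shows "\<exists>\<pi>'. is_path (E - {(v, v)}) s t \<pi>' \<and> path_weight w \<pi>' \<le> path_weight w \<pi>"
proof -
  obtain \<pi>' where *: "is_path E s t \<pi>'" "distinct \<pi>'" "path_weight w \<pi>' \<le> path_weight w \<pi>"
    using is_path_imp_distinct_path[OF assms(1), of w] assms(2) by blast
  have "(v, v) \<notin> set (path_edges \<pi>')"
    using *(2) by (induction \<pi>' rule: path_edges.induct) auto
  then have "is_path (E - {(v, v)}) s t \<pi>'"
    using *(1) unfolding is_path_iff by blast
  then show ?thesis using *(3) by blast
qed

text \<open>The strict gap yields a walk cheaper than everything that avoids \<open>f\<close>, so it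
  has to use \<open>f\<close>.\<close>

lemma gdist_less_witness:
  assumes "gdist H w s t < gdist (H - {f}) w s t"
  shows "\<exists>\<pi>. is_path H s t \<pi> \<and> f \<in> set (path_edges \<pi>) \<and> ereal (path_weight w \<pi>) < gdist (H - {f}) w s t"
proof -
  obtain \<pi> where \<pi>: "is_path H s t \<pi>" "ereal (path_weight w \<pi>) < gdist (H - {f}) w s t"
    using assms unfolding gdist_def[of H] by (auto simp: INF_less_iff)
  have "f \<in> set (path_edges \<pi>)"
  proof (rule ccontr)
    assume "f \<notin> set (path_edges \<pi>)"
    then have "is_path (H - {f}) s t \<pi>" using \<pi>(1) by (auto simp: is_path_iff)
    then show False using gdist_le \<pi>(2) by (metis not_less)
  qed
  then show ?thesis using \<pi> by blast
qed

lemma gdist_le_of_path_le: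
  assumes "is_path E s t \<sigma>" "path_weight w \<sigma> \<le> c"
  shows "gdist E w s t \<le> ereal c"
  using gdist_le[OF assms(1), of w] assms(2) by (meson ereal_less_eq(3) order_trans)

text \<open>Averaging over all subsets \<open>A\<close> of \<open>V\<close>: an edge with distinct
  ends leaves \<open>A\<close> for exactly a quarter of them.\<close>

lemma directed_cut_exists:
  fixes H :: "('a \<times> 'a) set"
  assumes fin: "finite V" and H: "H \<subseteq> V \<times> V" and irr: "\<And>v. (v, v) \<notin> H"
  shows "\<exists>A. card H \<le> 4 * card (H \<inter> A \<times> (- A))"
proof (rule ccontr)
  assume "\<not> ?thesis"
  then have less: "4 * card (H \<inter> A \<times> (- A)) < card H" for A by (meson not_less)
  have finH: "finite H" using fin H by (meson finite_SigmaI finite_subset)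
  have cnt: "4 * card {A \<in> Pow V. fst e \<in> A \<and> snd e \<notin> A} = 2 ^ card V" if "e \<in> H" for e
  proof -
    obtain u v where uv: "e = (u, v)" by (cases e)
    then have e: "e = (u, v)" "u \<in> V" "v \<in> V" "u \<noteq> v" using that H irr by auto
    have eq: "{A \<in> Pow V. fst e \<in> A \<and> snd e \<notin> A} = insert u ` Pow (V - {u, v})" (is "?L = ?R")
    proof
      show "?L \<subseteq> ?R"
      proof
        fix A assume "A \<in> ?L"
        then have "A = insert u (A - {u})" "A - {u} \<in> Pow (V - {u, v})" using e by auto
        then show "A \<in> ?R" by blast
      qed
    qed (use e in auto)
    have "inj_on (insert u) (Pow (V - {u, v}))" by (auto simp: inj_on_def)
    then have "card {A \<in> Pow V. fst e \<in> A \<and> snd e \<notin> A} = 2 ^ card (V - {u, v})"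
      unfolding eq using fin by (simp add: card_image card_Pow)
    moreover have "card (V - {u, v}) + 2 = card V"
    proof -
      have "card {u, v} \<le> card V" using e fin by (intro card_mono) auto
      then show ?thesis using e fin by (simp add: card_Diff_subset)
    qed
    ultimately show ?thesis by (simp flip: \<open>_ + 2 = _\<close> add: power_add)
  qed
  \<comment> \<open>Double counting of the pairs of a set \<open>A\<close> and an edge leaving
    it.\<close>
  have "(\<Sum>A\<in>Pow V. card (H \<inter> A \<times> (- A))) = (\<Sum>A\<in>Pow V. \<Sum>e\<in>H. if fst e \<in> A \<and> snd e \<notin> A then 1 else 0)"
  proof (intro sum.cong refl)
    fix A
    have "H \<inter> A \<times> (- A) = {e \<in> H. fst e \<in> A \<and> snd e \<notin> A}" by auto
    then show "card (H \<inter> A \<times> (- A)) = (\<Sum>e\<in>H. if fst e \<in> A \<and> snd e \<notin> A then 1 else 0)"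
      using finH by (simp add: sum.If_cases Int_def)
  qed
  also have "\<dots> = (\<Sum>e\<in>H. \<Sum>A\<in>Pow V. if fst e \<in> A \<and> snd e \<notin> A then 1 else 0)" by (rule sum.swap)
  also have "\<dots> = (\<Sum>e\<in>H. card {A \<in> Pow V. fst e \<in> A \<and> snd e \<notin> A})"
    using fin by (intro sum.cong refl) (simp add: sum.If_cases Int_def)
  finally have "4 * (\<Sum>A\<in>Pow V. card (H \<inter> A \<times> (- A))) = (\<Sum>e\<in>H. 2 ^ card V)"
    using cnt by (simp add: sum_distrib_left)
  moreover have "4 * (\<Sum>A\<in>Pow V. card (H \<inter> A \<times> (- A))) < (\<Sum>A\<in>Pow V. card H)"
    unfolding sum_distrib_left using fin less by (intro sum_strict_mono) auto
  ultimately show False using fin by (simp add: card_Pow)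
qed

text \<open>Only the part before the edge avoids \<open>X\<close>; the part after it is arbitrary
  but shorter, which suits an induction on the length.\<close>

lemma split_at_first_edge_in:
  assumes "is_path H a b \<pi>" "set (path_edges \<pi>) \<inter> X \<noteq> {}"
  shows "\<exists>\<alpha> u v \<beta>. is_path (H - X) a u \<alpha> \<and> (u, v) \<in> X \<and> is_path H v b \<beta> \<and> length \<beta> < length \<pi> \<and>
     path_weight w \<pi> = path_weight w \<alpha> + w (u, v) + path_weight w \<beta>"
  using assms
proof (induction \<pi> arbitrary: a rule: path_edges.induct)
  case (1 x y xs)
  show ?case
  proof (cases "(x, y) \<in> X")
    case True
    then show ?thesis using 1 by (intro exI[of _ "[a]"] exI[of _ a] exI[of _ y] exI[of _ "y # xs"]) auto
  next
    case False
    then have "set (path_edges (y # xs)) \<inter> X \<noteq> {}" "is_path H y b (y # xs)"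
      using "1.prems" by auto
    from "1.IH"[OF this(2,1)] obtain \<alpha> u v \<beta> where *: "is_path (H - X) y u \<alpha>" "(u, v) \<in> X" "is_path H v b \<beta>"
      "length \<beta> < length (y # xs)" "path_weight w (y # xs) = path_weight w \<alpha> + w (u, v) + path_weight w \<beta>"
      by blast
    obtain \<alpha>' where \<alpha>': "\<alpha> = y # \<alpha>'" using *(1) by (cases \<alpha>) (auto simp: is_path_iff)
    then have "is_path (H - X) a u (a # \<alpha>)" "path_weight w (a # \<alpha>) = w (a, y) + path_weight w \<alpha>"
      using * "1.prems" False by auto
    moreover have "length \<beta> < length (x # y # xs)"
      "path_weight w (x # y # xs) = path_weight w (a # \<alpha>) + w (u, v) + path_weight w \<beta>"
      using *(4,5) calculation(2) "1.prems" by auto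
    ultimately show ?thesis using * by blast
  qed
qed auto

text \<open>The instance that hides a subset \<open>X\<close> of a directed cut: the edges outside \<open>X\<close> are replaced by
  all shortcuts avoiding \<open>X\<close> except for those joining the ends of a cut edge.\<close>

definition hide_edges :: "nat \<Rightarrow> (nat \<times> nat) set \<Rightarrow> (nat \<times> nat) set \<Rightarrow> (nat \<times> nat) set \<Rightarrow> (nat \<times> nat) set" where
  "hide_edges n H F X = X \<union> {(a, b). a < n \<and> b < n \<and> (a, b) \<notin> F \<and> (\<exists>\<pi>. is_path (H - X) a b \<pi>)}"

text \<open>A shortcut is an edge only if a walk of \<open>H - X\<close> joins its ends, so for
  nonnegative \<open>w\<close> the distance is finite there and \<open>real_of_ereal\<close> loses
  nothing.\<close>

definition hide_weight ::
  "(nat \<times> nat) set \<Rightarrow> (nat \<times> nat \<Rightarrow> real) \<Rightarrow> (nat \<times> nat) set \<Rightarrow> nat \<times> nat \<Rightarrow> real" where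
  "hide_weight H w X e = (if e \<in> X then w e else real_of_ereal (gdist (H - X) w (fst e) (snd e)))"

context
  fixes n :: nat and H :: "(nat \<times> nat) set" and w :: "nat \<times> nat \<Rightarrow> real"
    and A :: "nat set" and F X :: "(nat \<times> nat) set"
  assumes H: "wgraph n H w" and F: "F = H \<inter> A \<times> (- A)" and X: "X \<subseteq> F"
begin

text \<open>A shortcut stands for a shortest walk of \<open>H - X\<close>, which avoids
  \<open>f\<close> because \<open>f\<close> is in \<open>X\<close>; an edge of \<open>X\<close>
  other than \<open>f\<close> stands for itself.\<close>

lemma hide_edge_expand:
  assumes "(a, b) \<in> hide_edges n H F X" "(a, b) \<noteq> f" "f \<in> X"
  shows "\<exists>\<pi>. is_path (H - {f}) a b \<pi> \<and> path_weight w \<pi> = hide_weight H w X (a, b)"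
proof (cases "(a, b) \<in> X")
  case True
  then show ?thesis using assms X F by (intro exI[of _ "[a, b]"]) (auto simp: hide_weight_def)
next
  case False
  then obtain \<pi> where \<pi>: "is_path (H - X) a b \<pi>" "a < n" using assms by (auto simp: hide_edges_def)
  have "wgraph n (H - X) w" using H by (auto simp: wgraph_def)
  then obtain \<pi> where "shortest (H - X) w a b \<pi>" using shortest_exists[OF \<pi>(1) _ \<pi>(2)] by blast
  then have "is_path (H - X) a b \<pi>" "ereal (path_weight w \<pi>) = gdist (H - X) w a b"
    by (auto simp: shortest_iff_gdist)
  then have "path_weight w \<pi> = hide_weight H w X (a, b)" "is_path (H - {f}) a b \<pi>"
    using False assms(3) by (auto simp: hide_weight_def intro: is_path_mono simp flip: \<open>ereal _ = _\<close>)
  then show ?thesis by blast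
qed

lemma wgraph_hide: "wgraph n (hide_edges n H F X) (hide_weight H w X)"
proof -
  have "X \<subseteq> {0..<n} \<times> {0..<n}" using X F H by (auto simp: wgraph_def)
  moreover have "0 \<le> hide_weight H w X e" if e: "e \<in> hide_edges n H F X" for e
  proof (cases "e \<in> X")
    case True
    then show ?thesis using X F H by (auto simp: wgraph_def hide_weight_def)
  next
    case False
    have "0 \<le> gdist (H - X) w (fst e) (snd e)"
      using H by (intro gdist_ge) (auto simp: wgraph_def intro!: path_weight_nonneg)
    then show ?thesis using False by (simp add: hide_weight_def real_of_ereal_pos)
  qed
  ultimately show ?thesis by (auto simp: wgraph_def hide_edges_def)
qed

lemma hide_path_expand:
  assumes "is_path (hide_edges n H F X) s t \<rho>" "f \<notin> set (path_edges \<rho>)" "f \<in> X"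
  shows "\<exists>\<pi>. is_path (H - {f}) s t \<pi> \<and> path_weight w \<pi> = path_weight (hide_weight H w X) \<rho>"
  using assms(1,2)
proof (induction \<rho> arbitrary: s rule: path_edges.induct)
  case (1 x y xs)
  obtain \<beta> where \<beta>: "is_path (H - {f}) y t \<beta>" "path_weight w \<beta> = path_weight (hide_weight H w X) (y # xs)"
    using 1 by fastforce
  obtain \<alpha> where \<alpha>: "is_path (H - {f}) s y \<alpha>" "path_weight w \<alpha> = hide_weight H w X (s, y)"
    using hide_edge_expand[of s y f] 1 assms(3) by auto
  show ?case
    using is_path_join[OF \<alpha>(1) \<beta>(1)] path_weight_join[OF \<alpha>(1) \<beta>(1), of w] \<alpha>(2) \<beta>(2) 1 by auto
next
  case ("2_2" v)
  then show ?case by (intro exI[of _ "[s]"]) auto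
qed auto

text \<open>The assumption on \<open>a\<close> and \<open>b\<close> keeps \<open>(a, b)\<close> out
  of the cut, so that it is not a forbidden shortcut.\<close>

lemma hide_shortcut:
  assumes "is_path (H - X) a b \<pi>" "a < n" "b < n" "a \<notin> A \<or> b \<in> A"
  shows "is_path (hide_edges n H F X) a b [a, b] \<and> path_weight (hide_weight H w X) [a, b] \<le> path_weight w \<pi>"
proof -
  have F': "(a, b) \<notin> F" using F assms(4) by auto
  have "0 \<le> gdist (H - X) w a b"
    using H by (intro gdist_ge) (auto simp: wgraph_def intro!: path_weight_nonneg)
  moreover have "gdist (H - X) w a b \<le> ereal (path_weight w \<pi>)" by (rule gdist_le[OF assms(1)])
  ultimately have "real_of_ereal (gdist (H - X) w a b) \<le> path_weight w \<pi>"
    by (cases "gdist (H - X) w a b") auto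
  then show ?thesis using F' X assms by (auto simp: hide_edges_def hide_weight_def)
qed

text \<open>Cut the walk at its first edge \<open>(u, v)\<close> in \<open>X\<close>. As
  \<open>u\<close> is in \<open>A\<close>, the shortcut from \<open>a\<close> to \<open>u\<close> is
  allowed; as \<open>v\<close> is not in \<open>A\<close>, the rest satisfies the assumption again.
  Without such an edge the start lies outside \<open>A\<close> and a single shortcut does.\<close>

lemma hide_path_shorten:
  assumes "is_path H a b \<pi>" "a < n" "b < n" "a \<notin> A \<or> set (path_edges \<pi>) \<inter> X \<noteq> {}"
  shows "\<exists>\<rho>. is_path (hide_edges n H F X) a b \<rho> \<and> path_weight (hide_weight H w X) \<rho> \<le> path_weight w \<pi>"
  using assms
proof (induction \<pi> arbitrary: a rule: length_induct)
  case (1 \<pi>)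
  show ?case
  proof (cases "set (path_edges \<pi>) \<inter> X = {}")
    case True
    then have "is_path (H - X) a b \<pi>" using "1.prems" by (auto simp: is_path_iff)
    then show ?thesis using hide_shortcut "1.prems" True by blast
  next
    case False
    obtain \<alpha> u v \<beta> where *: "is_path (H - X) a u \<alpha>" "(u, v) \<in> X" "is_path H v b \<beta>" "length \<beta> < length \<pi>"
      "path_weight w \<pi> = path_weight w \<alpha> + w (u, v) + path_weight w \<beta>"
      using split_at_first_edge_in[OF "1.prems"(1) False, of w] by blast
    have uv: "u \<in> A" "v \<notin> A" "u < n" "v < n" using * X F H by (auto simp: wgraph_def)
    obtain \<rho> where \<rho>: "is_path (hide_edges n H F X) v b \<rho>"
        "path_weight (hide_weight H w X) \<rho> \<le> path_weight w \<beta>"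
      using "1.IH" * uv "1.prems"(3) by blast
    obtain \<rho>' where \<rho>': "\<rho> = v # \<rho>'" using \<rho>(1) by (cases \<rho>) (auto simp: is_path_iff)
    have "(u, v) \<in> hide_edges n H F X" "hide_weight H w X (u, v) = w (u, v)"
      using *(2) by (auto simp: hide_edges_def hide_weight_def)
    \<comment> \<open>\<open>a = u\<close> is possible; the shortcut is then a loop of weight
      0.\<close>
    then have "is_path (hide_edges n H F X) a b (a # u # \<rho>)"
      "path_weight (hide_weight H w X) (a # u # \<rho>) \<le> path_weight w \<pi>"
      using hide_shortcut[OF *(1) "1.prems"(2) uv(3)] uv \<rho> \<rho>' *(5) by auto
    then show ?thesis by blast
  qed
qed

text \<open>If \<open>\<rho>\<close> avoided \<open>f\<close>, it would expand to a walk of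
  \<open>H - {f}\<close> of the same weight. But shortening a walk of \<open>H\<close> that beats
  all walks of \<open>H - {f}\<close> shows that \<open>\<rho>\<close> is too cheap for
  that.\<close>

lemma hide_shortest_contains:
  assumes f: "f \<in> X" and st: "s < n" "t < n" and less: "gdist H w s t < gdist (H - {f}) w s t"
    and \<rho>: "shortest (hide_edges n H F X) (hide_weight H w X) s t \<rho>"
  shows "f \<in> set (path_edges \<rho>)"
proof (rule ccontr)
  assume no: "f \<notin> set (path_edges \<rho>)"
  obtain \<pi> where \<pi>: "is_path H s t \<pi>" "f \<in> set (path_edges \<pi>)"
      "ereal (path_weight w \<pi>) < gdist (H - {f}) w s t"
    using gdist_less_witness[OF less] by blast
  obtain \<rho>' where \<rho>': "is_path (hide_edges n H F X) s t \<rho>'"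
      "path_weight (hide_weight H w X) \<rho>' \<le> path_weight w \<pi>"
    using hide_path_shorten[OF \<pi>(1) st] \<pi>(2) f by blast
  obtain \<sigma> where \<sigma>: "is_path (H - {f}) s t \<sigma>" "path_weight w \<sigma> = path_weight (hide_weight H w X) \<rho>"
    using hide_path_expand[OF _ no f] \<rho> unfolding shortest_def by blast
  have "path_weight w \<sigma> \<le> path_weight w \<pi>"
    using \<rho> \<rho>' \<sigma>(2) unfolding shortest_def by force
  then show False using gdist_le_of_path_le[OF \<sigma>(1)] \<pi>(3) by (meson not_less)
qed

end

section \<open>Counting the hidden instances\<close>

lemma is_spo_Some_shortest:
  assumes "is_spo D b E w P" "(s, t) \<in> P" "is_path E s t \<pi>"
  shows "\<exists>\<rho>. D b (s, t) = Some \<rho> \<and> shortest E w s t \<rho>"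
  using assms unfolding is_spo_def shortest_iff_gdist
  by (auto split: option.splits dest!: bspec)

text \<open>One decoder and one demand set serve the instances for all subsets of a cut
  \<open>F\<close>, and the answers reveal the subset.\<close>

lemma spo_size_ge_dist_preserver:
  assumes G: "wgraph n E w" and P: "P \<subseteq> {0..<n} \<times> {0..<n}"
    and min: "\<And>H. dist_preserver E w P H \<Longrightarrow> m \<le> card H"
    and D: "\<And>E w. wgraph n E w \<Longrightarrow> \<exists>b. length b \<le> k \<and> is_spo D b E w P"
  shows "m \<le> 4 * k"
proof -
  have finE: "finite E" using G finite_subset by (auto simp: wgraph_def)
  \<comment> \<open>In a preserver of least cardinality, deleting any edge increases the distance of
    some demand pair.\<close>
  obtain H where H: "dist_preserver E w P H" "\<And>H'. dist_preserver E w P H' \<Longrightarrow> card H \<le> card H'"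
    using ex_has_least_nat[of "dist_preserver E w P" E card] unfolding dist_preserver_def by blast
  have HE: "H \<subseteq> E" and finH: "finite H" using H(1) finE finite_subset by (auto simp: dist_preserver_def)
  have GH: "wgraph n H w" using G HE by (auto simp: wgraph_def)
  have nec: "\<exists>s t. (s, t) \<in> P \<and> gdist H w s t < gdist (H - {e}) w s t" if e: "e \<in> H" for e
  proof -
    have "\<not> dist_preserver E w P (H - {e})"
      using H(2)[of "H - {e}"] e finH by (metis card_Diff1_less not_less)
    then obtain s t where st: "(s, t) \<in> P" "gdist (H - {e}) w s t \<noteq> gdist E w s t"
      using HE by (auto simp: dist_preserver_def)
    moreover have "gdist H w s t = gdist E w s t" using H(1) st(1) by (auto simp: dist_preserver_def)
    moreover have "gdist H w s t \<le> gdist (H - {e}) w s t" by (rule gdist_mono) auto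
    ultimately show ?thesis by (metis order_le_imp_less_or_eq)
  qed
  have irr: "(v, v) \<notin> H" for v
  proof
    assume "(v, v) \<in> H"
    then obtain s t where "gdist H w s t < gdist (H - {(v, v)}) w s t" using nec by blast
    then obtain \<pi> where \<pi>: "is_path H s t \<pi>" "ereal (path_weight w \<pi>) < gdist (H - {(v, v)}) w s t"
      unfolding gdist_def[of H] by (auto simp: INF_less_iff)
    obtain \<pi>' where "is_path (H - {(v, v)}) s t \<pi>'" "path_weight w \<pi>' \<le> path_weight w \<pi>"
      using is_path_remove_loop[OF \<pi>(1), of w v] GH by (auto simp: wgraph_def)
    then show False using gdist_le_of_path_le \<pi>(2) by (meson not_less)
  qed
  obtain A where A: "card H \<le> 4 * card (H \<inter> A \<times> (- A))"
    using directed_cut_exists[of "{0..<n}" H] GH irr by (auto simp: wgraph_def)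
  define F where "F = H \<inter> A \<times> (- A)"
  have finF: "finite F" using finH F_def by auto
  \<comment> \<open>Reads off the answers which cut edges are in use; on the instance built from
    \<open>X\<close> the result will be \<open>X\<close> itself.\<close>
  define U where "U = (\<lambda>b. F \<inter> (\<Union>q\<in>P. case D b q of None \<Rightarrow> {} | Some \<rho> \<Rightarrow> set (path_edges \<rho>)))"
  have ex: "\<exists>b. length b \<le> k \<and> U b = X" if X: "X \<subseteq> F" for X
  proof -
    let ?E = "hide_edges n H F X" and ?w = "hide_weight H w X"
    obtain b where b: "length b \<le> k" "is_spo D b ?E ?w P" using D[OF wgraph_hide[OF GH F_def X]] by blast
    have "X \<subseteq> U b"
    proof
      fix f assume f: "f \<in> X"
      then obtain s t where st: "(s, t) \<in> P" "gdist H w s t < gdist (H - {f}) w s t" using nec X F_def by blast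
      then have stn: "s < n" "t < n" using P by auto
      have "\<exists>\<rho>. is_path ?E s t \<rho>"
        using gdist_less_witness[OF st(2)] hide_path_shorten[OF GH F_def X _ stn] f by blast
      then obtain \<rho> where \<rho>: "D b (s, t) = Some \<rho>" "shortest ?E ?w s t \<rho>"
        using is_spo_Some_shortest[OF b(2) st(1)] by blast
      then have "f \<in> set (path_edges \<rho>)" using hide_shortest_contains[OF GH F_def X f stn st(2)] by blast
      then show "f \<in> U b" using f X \<rho>(1) st(1) unfolding U_def by (auto intro!: bexI[of _ "(s, t)"])
    qed
    \<comment> \<open>No shortcut joins the ends of a cut edge, so the only edges of
      \<open>F\<close> in the instance are those of \<open>X\<close>.\<close>
    moreover have "U b \<subseteq> X"
    proof
      fix f assume "f \<in> U b"
      then obtain s t \<rho> where *: "f \<in> F" "(s, t) \<in> P" "D b (s, t) = Some \<rho>" "f \<in> set (path_edges \<rho>)"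
        unfolding U_def by (auto split: option.splits)
      then have "is_path ?E s t \<rho>" using b(2) unfolding is_spo_def by (auto dest!: bspec)
      then have "f \<in> ?E" using *(4) by (auto simp: is_path_iff)
      then show "f \<in> X" using *(1) by (auto simp: hide_edges_def)
    qed
    ultimately show ?thesis using b(1) by blast
  qed
  let ?B = "{b :: bool list. set b \<subseteq> UNIV \<and> length b \<le> k}"
  have finB: "finite ?B" by (rule finite_lists_length_le) simp
  have "Pow F \<subseteq> U ` ?B"
  proof
    fix X assume "X \<in> Pow F"
    then obtain b where "length b \<le> k" "U b = X" using ex by blast
    then show "X \<in> U ` ?B" by (intro image_eqI[of _ _ b]) auto
  qed
  \<comment> \<open>Fewer than \<open>2 ^ Suc k\<close> bit strings have length at most
    \<open>k\<close>, hence \<open>card F\<close> is at most \<open>k\<close>. The factor 4 of the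
    claim is the loss from passing to the cut.\<close>
  then have "card (Pow F) \<le> card ?B" by (rule surj_card_le[OF finB])
  also have "\<dots> = (\<Sum>i\<le>k. 2 ^ i)" by (subst card_lists_length_le) auto
  also have "\<dots> < 2 ^ Suc k" by (induction k) auto
  finally have "(2::nat) ^ card F < 2 ^ Suc k" using finF by (simp add: card_Pow)
  then have "card F \<le> k" by (simp only: power_strict_increasing_iff one_less_numeral_iff semiring_norm less_Suc_eq_le)
  then show ?thesis using A min[OF H(1)] unfolding F_def by linarith
qed

section \<open>Unique shortest paths by perturbation\<close>

lemma finite_positive_gap:
  fixes S :: "real set"
  assumes "finite S"
  shows "\<exists>\<epsilon>>0. \<forall>x\<in>S. 0 < x \<longrightarrow> \<epsilon> \<le> x"
proof -
  \<comment> \<open>The element 1 keeps the minimum defined if \<open>S\<close> has no positive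
    element.\<close>
  let ?T = "insert 1 {x \<in> S. 0 < x}"
  have fin: "finite ?T" using assms by simp
  have "Min ?T \<in> ?T" by (rule Min_in[OF fin]) simp
  then have "0 < Min ?T" by (metis (mono_tags, lifting) insertE mem_Collect_eq zero_less_one)
  moreover have "Min ?T \<le> x" if "x \<in> S" "0 < x" for x using Min_le[OF fin] that by blast
  ultimately show ?thesis by blast
qed

lemma distinct_path_edges: "distinct \<pi> \<Longrightarrow> distinct (path_edges \<pi>)"
proof (induction \<pi> rule: path_edges.induct)
  case (1 x y xs)
  then show ?case using set_path_edges_subset[of "y # xs"] by auto
qed auto

text \<open>A path without repeated vertices never returns to its first vertex, so at most one of
  its edges leaves that vertex, and this edge determines the next vertex.\<close>

lemma distinct_path_determined_by_edges:
  assumes "is_path E s t \<pi>" "is_path E s t' \<pi>'" "distinct \<pi>" "distinct \<pi>'"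
    "set (path_edges \<pi>) = set (path_edges \<pi>')"
  shows "\<pi> = \<pi>'"
  using assms
proof (induction \<pi> arbitrary: \<pi>' s rule: path_edges.induct)
  case (1 x y xs)
  from "1.prems" obtain y' ys where \<pi>': "\<pi>' = x # y' # ys"
    by (cases \<pi>' rule: path_edges.cases) (auto simp: is_path_iff)
  have x: "(x, v) \<notin> set (path_edges (y # xs))" "(x, v) \<notin> set (path_edges (y' # ys))" for v
    using "1.prems" \<pi>' set_path_edges_subset[of "y # xs"] set_path_edges_subset[of "y' # ys"] by auto
  have "(x, y) \<in> set (path_edges \<pi>')" using "1.prems"(5) by auto
  then have y: "y' = y" using \<pi>' x by auto
  have "set (path_edges (y # xs)) = set (path_edges (y # ys))"
    using "1.prems"(5) \<pi>' y x[of y] by (auto simp: insert_eq_iff)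
  moreover have "is_path E y t (y # xs)" "is_path E y t' (y # ys)" using "1.prems" \<pi>' y by auto
  moreover have "distinct (y # xs)" "distinct (y # ys)" using "1.prems" \<pi>' y by auto
  ultimately have "y # xs = y # ys" using "1.IH" by blast
  then show ?case using \<pi>' y by simp
next
  case ("2_2" v)
  then show ?case by (cases \<pi>' rule: path_edges.cases) auto
qed auto

lemma path_weight_add_scaled:
  "path_weight (\<lambda>e. w e + \<delta> * c e) \<pi> = path_weight w \<pi> + \<delta> * path_weight c \<pi>"
  by (simp add: path_weight_eq sum_list_addf sum_list_const_mult)

text \<open>With distinct powers of two, the weight of a simple path is the binary code of its edge
  set, so different edge sets have different weights.\<close>

definition edge_code :: "nat \<times> nat \<Rightarrow> real" where
  "edge_code e = 2 ^ prod_encode e"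

lemma path_weight_edge_code:
  assumes "distinct \<pi>"
  shows "path_weight edge_code \<pi> = real (set_encode (prod_encode ` set (path_edges \<pi>)))"
proof -
  have "path_weight edge_code \<pi> = sum edge_code (set (path_edges \<pi>))"
    using distinct_path_edges[OF assms] by (simp add: path_weight_eq sum_list_distinct_conv_sum_set)
  also have "\<dots> = real (\<Sum>e\<in>set (path_edges \<pi>). 2 ^ prod_encode e)"
    by (simp add: edge_code_def)
  also have "(\<Sum>e\<in>set (path_edges \<pi>). 2 ^ prod_encode e) = set_encode (prod_encode ` set (path_edges \<pi>))"
    unfolding set_encode_def by (simp add: sum.reindex inj_on_def)
  finally show ?thesis .
qed

text \<open>A repeated vertex would give a closed walk of positive weight, whose removal makes the
  walk cheaper.\<close>

lemma shortest_distinct: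
  assumes "shortest E w s t \<pi>" "\<And>e. e \<in> E \<Longrightarrow> 0 < w e"
  shows "distinct \<pi>"
proof (rule ccontr)
  assume "\<not> distinct \<pi>"
  moreover have "is_path E s t \<pi>" using assms(1) by (simp add: shortest_def)
  ultimately obtain \<pi>' y ys where *: "is_path E s t \<pi>'" "is_path E y y (y # ys @ [y])"
    "\<And>w. path_weight w \<pi> = path_weight w \<pi>' + path_weight w (y # ys @ [y])"
    by (metis is_path_shortcut)
  obtain z zs where z: "ys @ [y] = z # zs" by (cases "ys @ [y]") auto
  have "0 < w (y, z)" "is_path E z y (z # zs)" using *(2) assms(2) z by auto
  moreover from this(2) have "0 \<le> path_weight w (z # zs)"
    by (rule path_weight_nonneg) (simp add: assms(2) less_imp_le)
  ultimately have "0 < path_weight w (y # ys @ [y])" using z by auto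
  then show False using *(1,3) assms(1) unfolding shortest_def by (metis add_le_same_cancel1 not_less)
qed

locale unique_shortest =
  fixes n :: nat and E :: "(nat \<times> nat) set" and w :: "nat \<times> nat \<Rightarrow> real"
  assumes G: "wgraph n E w" and pos: "\<And>e. e \<in> E \<Longrightarrow> 0 < w e"
    and unique: "\<And>s t \<pi> \<pi>'. s < n \<Longrightarrow> shortest E w s t \<pi> \<Longrightarrow> shortest E w s t \<pi>' \<Longrightarrow> \<pi> = \<pi>'"

text \<open>The edge codes are added with a small factor: strict comparisons between simple paths
  survive, ties are broken by the edge sets, and all weights become positive.\<close>

lemma unique_shortest_perturbation:
  assumes G: "wgraph n E w"
  shows "\<exists>w'. unique_shortest n E w' \<and> (\<forall>s t \<pi>. s < n \<longrightarrow> shortest E w' s t \<pi> \<longrightarrow> shortest E w s t \<pi>)"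
proof -
  let ?T = "{\<pi>. set \<pi> \<subseteq> {0..<n} \<and> distinct \<pi>}" and ?c = "path_weight edge_code"
  have EV: "E \<subseteq> {0..<n} \<times> {0..<n}" "\<And>e. e \<in> E \<Longrightarrow> 0 \<le> w e" using G by (auto simp: wgraph_def)
  have c0: "0 \<le> ?c \<pi>" for \<pi> by (auto simp: path_weight_eq edge_code_def intro!: sum_list_nonneg)
  have finT: "finite ?T" by (simp add: finite_subset_distinct)
  \<comment> \<open>If \<open>\<epsilon>\<close> is at most every positive value of
    \<open>g\<close>, then a strictly cheaper \<open>\<pi>\<close> stays strictly cheaper than
    \<open>\<rho>\<close>. The summand 1 makes the denominator positive and leaves a strict
    surplus.\<close>
  define g where "g = (\<lambda>(\<pi>, \<rho>). (path_weight w \<rho> - path_weight w \<pi>) / (?c \<pi> + 1))"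
  have "finite (g ` (?T \<times> ?T))" using finT by simp
  from finite_positive_gap[OF this]
  obtain \<epsilon> where \<epsilon>: "\<epsilon> > 0" "\<forall>x\<in>g ` (?T \<times> ?T). 0 < x \<longrightarrow> \<epsilon> \<le> x" by blast
  define w' where "w' = (\<lambda>e. w e + \<epsilon> * edge_code e)"
  have w'_eq: "path_weight w' \<pi> = path_weight w \<pi> + \<epsilon> * ?c \<pi>" for \<pi>
    unfolding w'_def by (rule path_weight_add_scaled)
  have strict: "path_weight w' \<pi> < path_weight w' \<rho>"
    if "\<pi> \<in> ?T" "\<rho> \<in> ?T" "path_weight w \<pi> < path_weight w \<rho>" for \<pi> \<rho>
  proof -
    have "0 < g (\<pi>, \<rho>)" using that(3) c0[of \<pi>] by (auto simp: g_def intro!: divide_pos_pos)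
    then have "\<epsilon> \<le> g (\<pi>, \<rho>)" using \<epsilon>(2) that by blast
    then have "\<epsilon> * (?c \<pi> + 1) \<le> path_weight w \<rho> - path_weight w \<pi>"
      using c0[of \<pi>] by (simp add: g_def pos_le_divide_eq)
    moreover have "0 \<le> \<epsilon> * ?c \<rho>" using \<epsilon>(1) c0 by simp
    ultimately show ?thesis using \<epsilon>(1) by (simp add: w'_eq algebra_simps)
  qed
  have pos: "0 < w' e" if "e \<in> E" for e
    using EV(2)[OF that] \<epsilon>(1) by (auto simp: w'_def edge_code_def add_nonneg_pos)
  have G': "wgraph n E w'" using EV(1) pos by (auto simp: wgraph_def less_imp_le)
  have inT: "\<pi> \<in> ?T" if "s < n" "is_path E s t \<pi>" "distinct \<pi>" for s t \<pi>
    using is_path_set[OF that(2) EV(1)] that by auto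
  have sh: "shortest E w s t \<pi>" if s: "s < n" and \<pi>: "shortest E w' s t \<pi>" for s t \<pi>
    unfolding shortest_def
  proof (intro conjI allI impI)
    show p: "is_path E s t \<pi>" using \<pi> by (simp add: shortest_def)
    fix \<rho> assume "is_path E s t \<rho>"
    then obtain \<rho>' where \<rho>': "is_path E s t \<rho>'" "distinct \<rho>'" "path_weight w \<rho>' \<le> path_weight w \<rho>"
      using is_path_imp_distinct_path[of E s t \<rho> w] EV(2) by blast
    have "\<not> path_weight w \<rho>' < path_weight w \<pi>"
      using strict[of \<rho>' \<pi>] inT[OF s \<rho>'(1,2)] inT[OF s p] shortest_distinct[OF \<pi> pos] \<rho>'(1) \<pi>
      unfolding shortest_def by (meson not_less)
    then show "path_weight w \<pi> \<le> path_weight w \<rho>" using \<rho>'(3) by linarith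
  qed
  have "unique_shortest n E w'"
  proof
    fix s t \<pi> \<pi>' assume s: "s < n" and \<pi>: "shortest E w' s t \<pi>" and \<pi>': "shortest E w' s t \<pi>'"
    have p: "is_path E s t \<pi>" "is_path E s t \<pi>'" using \<pi> \<pi>' by (auto simp: shortest_def)
    have d: "distinct \<pi>" "distinct \<pi>'" using \<pi> \<pi>' shortest_distinct pos by blast+
    have "path_weight w' \<pi> = path_weight w' \<pi>'" "path_weight w \<pi> = path_weight w \<pi>'"
      using \<pi> \<pi>' sh[OF s \<pi>] sh[OF s \<pi>'] unfolding shortest_def by (simp_all add: antisym)
    then have "?c \<pi> = ?c \<pi>'" using \<epsilon>(1) by (simp add: w'_eq)
    then have "set_encode (prod_encode ` set (path_edges \<pi>)) = set_encode (prod_encode ` set (path_edges \<pi>'))"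
      using d by (simp add: path_weight_edge_code)
    then have "prod_encode ` set (path_edges \<pi>) = prod_encode ` set (path_edges \<pi>')"
      by (simp add: set_encode_eq)
    then have "set (path_edges \<pi>) = set (path_edges \<pi>')"
      by (metis inj_image_eq_iff inj_prod_encode)
    then show "\<pi> = \<pi>'" using distinct_path_determined_by_edges p d by blast
  qed (use G' pos in auto)
  then show ?thesis using sh by blast
qed

section \<open>Segments of unique shortest paths and sequences of hops\<close>

context unique_shortest
begin

definition sp :: "nat \<Rightarrow> nat \<Rightarrow> nat list" where
  "sp x y = (SOME \<pi>. shortest E w x y \<pi>)"

text \<open>On \<open>reach\<close> this is the distance for \<open>w\<close>; elsewhere the value
  carries no meaning.\<close>

definition D :: "nat \<times> nat \<Rightarrow> real" where
  "D e = path_weight w (sp (fst e) (snd e))"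

definition reach :: "(nat \<times> nat) set" where
  "reach = {(x, y). x < n \<and> y < n \<and> (\<exists>\<pi>. is_path E x y \<pi>)}"

lemma shortest_sp: "(x, y) \<in> reach \<Longrightarrow> shortest E w x y (sp x y)"
  unfolding sp_def reach_def by (auto dest!: shortest_exists[OF _ G] intro: someI)

lemma shortest_imp_sp: "x < n \<Longrightarrow> shortest E w x y \<pi> \<Longrightarrow> \<pi> = sp x y"
  unfolding sp_def using unique by (metis someI)

lemma D_le: "(x, y) \<in> reach \<Longrightarrow> is_path E x y \<pi> \<Longrightarrow> D (x, y) \<le> path_weight w \<pi>"
  using shortest_sp by (auto simp: D_def shortest_def)

lemma shortest_in_range:
  assumes "shortest E w s t \<pi>" "s < n"
  shows "set \<pi> \<subseteq> {0..<n}"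
proof -
  have "is_path E s t \<pi>" using assms(1) by (simp add: shortest_def)
  then show ?thesis using is_path_set[of E s t \<pi> "{0..<n}"] G assms(2) by (simp add: wgraph_def)
qed

text \<open>Exchange argument: a cheaper prefix followed by the old rest would beat the whole
  path.\<close>

lemma shortest_take:
  assumes "shortest E w s t \<pi>" "b < length \<pi>"
  shows "shortest E w s (\<pi> ! b) (take (Suc b) \<pi>)"
  unfolding shortest_def
proof (intro conjI allI impI)
  have p: "is_path E s t \<pi>" using assms(1) by (simp add: shortest_def)
  show "is_path E s (\<pi> ! b) (take (Suc b) \<pi>)" by (rule is_path_take[OF p assms(2)])
  fix \<rho> assume \<rho>: "is_path E s (\<pi> ! b) \<rho>"
  note d = is_path_drop[OF p assms(2)]
  have "path_weight w \<pi> \<le> path_weight w (\<rho> @ tl (drop b \<pi>))"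
    using assms(1) is_path_join[OF \<rho> d] by (simp only: shortest_def)
  then show "path_weight w (take (Suc b) \<pi>) \<le> path_weight w \<rho>"
    using path_weight_take_drop[OF p assms(2), of w] path_weight_join[OF \<rho> d, of w] by linarith
qed

lemma shortest_drop:
  assumes "shortest E w s t \<pi>" "a < length \<pi>"
  shows "shortest E w (\<pi> ! a) t (drop a \<pi>)"
  unfolding shortest_def
proof (intro conjI allI impI)
  have p: "is_path E s t \<pi>" using assms(1) by (simp add: shortest_def)
  show "is_path E (\<pi> ! a) t (drop a \<pi>)" by (rule is_path_drop[OF p assms(2)])
  fix \<rho> assume \<rho>: "is_path E (\<pi> ! a) t \<rho>"
  note d = is_path_take[OF p assms(2)]
  have "path_weight w \<pi> \<le> path_weight w (take (Suc a) \<pi> @ tl \<rho>)"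
    using assms(1) is_path_join[OF d \<rho>] by (simp only: shortest_def)
  then show "path_weight w (drop a \<pi>) \<le> path_weight w \<rho>"
    using path_weight_take_drop[OF p assms(2), of w] path_weight_join[OF d \<rho>, of w] by linarith
qed

lemma shortest_segment:
  assumes "shortest E w s t \<pi>" "a \<le> b" "b < length \<pi>"
  shows "shortest E w (\<pi> ! a) (\<pi> ! b) (take (Suc (b - a)) (drop a \<pi>))"
  using shortest_take[OF shortest_drop[OF assms(1), of a], of "b - a"] assms by simp

text \<open>Both segments are shortest walks between the same ends, hence equal as lists by
  uniqueness.\<close>

lemma shortest_segments_agree:
  assumes "shortest E w s t \<pi>" "shortest E w s' t' \<pi>'" "s < n"
    and ab: "a \<le> b" "b < length \<pi>" and cd: "c \<le> d" "d < length \<pi>'"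
    and eq: "\<pi> ! a = \<pi>' ! c" "\<pi> ! b = \<pi>' ! d"
  shows "b - a = d - c \<and> (\<forall>j\<le>b - a. \<pi> ! (a + j) = \<pi>' ! (c + j))"
proof -
  have "\<pi> ! a < n" using shortest_in_range[OF assms(1,3)] ab nth_mem[of a \<pi>] by fastforce
  then have *: "take (Suc (b - a)) (drop a \<pi>) = take (Suc (d - c)) (drop c \<pi>')"
    using shortest_segment[OF assms(1) ab] shortest_segment[OF assms(2) cd] eq unique by metis
  have "length (take (Suc (b - a)) (drop a \<pi>)) = length (take (Suc (d - c)) (drop c \<pi>'))"
    using * by simp
  then have l: "b - a = d - c" using ab cd by simp
  moreover have "\<pi> ! (a + j) = \<pi>' ! (c + j)" if "j \<le> b - a" for j
    using arg_cong[OF *, of "\<lambda>xs. xs ! j"] that l ab cd by simp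
  ultimately show ?thesis by blast
qed

text \<open>Every hop is replaced by its shortest path; \<open>c k\<close> is the position at which
  the expansion \<open>\<mu>\<close> reaches the \<open>k\<close>-th vertex of
  \<open>\<rho>\<close>.\<close>

lemma expand_reach_path:
  assumes "is_path reach s t \<rho>"
  shows "\<exists>\<mu> c. is_path E s t \<mu> \<and> path_weight w \<mu> = path_weight D \<rho> \<and> c 0 = (0::nat) \<and>
    c (length \<rho> - 1) = length \<mu> - 1 \<and> (\<forall>k. Suc k < length \<rho> \<longrightarrow> c k \<le> c (Suc k)) \<and>
    (\<forall>k<length \<rho>. c k < length \<mu> \<and> \<mu> ! c k = \<rho> ! k)"
  using assms
proof (induction \<rho> arbitrary: s rule: path_edges.induct)
  case (1 x y xs)
  have xs: "x = s" "(s, y) \<in> reach" "is_path reach y t (y # xs)" using "1.prems" by auto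
  from "1.IH"[OF xs(3)] obtain \<mu> c where \<mu>: "is_path E y t \<mu>" "path_weight w \<mu> = path_weight D (y # xs)"
    "c 0 = 0" "c (length (y # xs) - 1) = length \<mu> - 1"
    "\<And>k. Suc k < length (y # xs) \<Longrightarrow> c k \<le> c (Suc k)"
    "\<And>k. k < length (y # xs) \<Longrightarrow> c k < length \<mu> \<and> \<mu> ! c k = (y # xs) ! k" by blast
  have \<alpha>: "is_path E s y (sp s y)" using shortest_sp[OF xs(2)] by (simp add: shortest_def)
  define \<nu> where "\<nu> = sp s y @ tl \<mu>"
  \<comment> \<open>Positions in the tail are shifted by the number of edges of the first segment,
    as the shared vertex occurs only once.\<close>
  define c' where "c' = (\<lambda>k. case k of 0 \<Rightarrow> 0 | Suc j \<Rightarrow> length (sp s y) - 1 + c j)"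
  have len: "0 < length (sp s y)" "0 < length \<mu>" using \<alpha> \<mu>(1) is_path_ends by blast+
  have l\<nu>: "length \<nu> = length (sp s y) - 1 + length \<mu>" using len by (cases \<mu>) (auto simp: \<nu>_def)
  have nth: "\<nu> ! (length (sp s y) - 1 + i) = \<mu> ! i" if "i < length \<mu>" for i
  proof (cases i)
    case 0
    then show ?thesis using len is_path_ends[OF \<alpha>] is_path_ends[OF \<mu>(1)] by (simp add: \<nu>_def nth_append)
  next
    case (Suc j)
    then have "length (sp s y) - 1 + i = length (sp s y) + j" using len by simp
    then show ?thesis using Suc that by (simp only: \<nu>_def nth_append_length_plus) (simp add: nth_tl)
  qed
  have n0: "\<nu> ! 0 = s" using len is_path_ends[OF \<alpha>] by (simp add: \<nu>_def nth_append)
  show ?case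
  proof (intro exI conjI allI impI)
    show "is_path E s t \<nu>" unfolding \<nu>_def by (rule is_path_join[OF \<alpha> \<mu>(1)])
    show "path_weight w \<nu> = path_weight D (x # y # xs)"
      unfolding \<nu>_def path_weight_join[OF \<alpha> \<mu>(1)] using \<mu>(2) xs(1) by (simp add: D_def)
    show "c' 0 = 0" by (simp add: c'_def)
    show "c' (length (x # y # xs) - 1) = length \<nu> - 1" using \<mu>(4) l\<nu> len by (cases \<mu>; cases "sp s y") (auto simp: c'_def)
    show "c' k \<le> c' (Suc k)" if "Suc k < length (x # y # xs)" for k
      using that \<mu>(5) by (cases k) (auto simp: c'_def)
    show "c' k < length \<nu>" if "k < length (x # y # xs)" for k
    proof (cases k)
      case 0
      then show ?thesis using l\<nu> len(2) by (simp add: c'_def)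
    next
      case (Suc j)
      then have "c j < length \<mu>" "c' k = length (sp s y) - 1 + c j" using that \<mu>(6) by (auto simp: c'_def)
      then show ?thesis using l\<nu> by linarith
    qed
    show "\<nu> ! c' k = (x # y # xs) ! k" if "k < length (x # y # xs)" for k
      using that \<mu>(6) nth n0 xs(1) by (cases k) (auto simp: c'_def)
  qed
next
  case ("2_2" v)
  then show ?case by (intro exI[of _ "[s]"] exI[of _ "\<lambda>_. 0"]) auto
qed auto

lemma D_le_reach_path:
  assumes "is_path reach s t \<rho>" "(s, t) \<in> reach"
  shows "D (s, t) \<le> path_weight D \<rho>"
  using expand_reach_path[OF assms(1)] D_le[OF assms(2)] by metis

text \<open>A tight sequence of hops expands to a shortest walk, which by uniqueness is a prefix of
  \<open>\<pi>\<close>; so its vertices lie on \<open>\<pi>\<close> in order.\<close>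

lemma tight_reach_path_positions:
  assumes \<rho>: "is_path reach s (\<pi> ! e) \<rho>" and \<pi>: "shortest E w s t \<pi>" "s < n" "e < length \<pi>"
    and tight: "path_weight D \<rho> = D (s, \<pi> ! e)"
  shows "\<exists>c. c 0 = (0::nat) \<and> c (length \<rho> - 1) = e \<and> (\<forall>k. Suc k < length \<rho> \<longrightarrow> c k \<le> c (Suc k)) \<and>
    (\<forall>k<length \<rho>. c k < length \<pi> \<and> \<pi> ! c k = \<rho> ! k)"
proof -
  obtain \<mu> c where \<mu>: "is_path E s (\<pi> ! e) \<mu>" "path_weight w \<mu> = path_weight D \<rho>" "c 0 = (0::nat)"
    "c (length \<rho> - 1) = length \<mu> - 1" "\<And>k. Suc k < length \<rho> \<Longrightarrow> c k \<le> c (Suc k)"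
    "\<And>k. k < length \<rho> \<Longrightarrow> c k < length \<mu> \<and> \<mu> ! c k = \<rho> ! k"
    using expand_reach_path[OF \<rho>] by blast
  have t: "shortest E w s (\<pi> ! e) (take (Suc e) \<pi>)" by (rule shortest_take[OF \<pi>(1,3)])
  then have "take (Suc e) \<pi> = sp s (\<pi> ! e)" by (rule shortest_imp_sp[OF \<pi>(2)])
  then have "path_weight w \<mu> = path_weight w (take (Suc e) \<pi>)" using \<mu>(2) tight by (simp add: D_def)
  then have "shortest E w s (\<pi> ! e) \<mu>" using t \<mu>(1) by (simp add: shortest_def)
  then have "\<mu> = take (Suc e) \<pi>" using unique[OF \<pi>(2)] t by blast
  then have "length \<mu> - 1 = e" "\<And>i. i < length \<mu> \<Longrightarrow> i < length \<pi> \<and> \<mu> ! i = \<pi> ! i" using \<pi>(3) by auto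
  then have "\<forall>k<length \<rho>. c k < length \<pi> \<and> \<pi> ! c k = \<rho> ! k" "c (length \<rho> - 1) = e"
    using \<mu>(4,6) by metis+
  then show ?thesis using \<mu>(3,5) by blast
qed

end

section \<open>Codes for consistent path systems\<close>

type_synonym phrase = "(nat \<times> nat) \<times> nat \<times> nat \<times> nat \<times> (nat \<times> nat)"

definition consistent :: "'q set \<Rightarrow> ('q \<Rightarrow> 'v list) \<Rightarrow> bool" where
  "consistent Q A \<longleftrightarrow> (\<forall>q\<in>Q. \<forall>q'\<in>Q. \<forall>a b c d. a \<le> b \<and> b < length (A q) \<and> c \<le> d \<and> d < length (A q') \<and>
     A q ! a = A q' ! c \<and> A q ! b = A q' ! d \<longrightarrow>
     b - a = d - c \<and> (\<forall>j\<le>b - a. A q ! (a + j) = A q' ! (c + j)))"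

lemma consistentD:
  assumes "consistent Q A" "q \<in> Q" "q' \<in> Q" "a \<le> b" "b < length (A q)" "c \<le> d" "d < length (A q')"
    "A q ! a = A q' ! c" "A q ! b = A q' ! d"
  shows "b - a = d - c" "\<And>j. j \<le> b - a \<Longrightarrow> A q ! (a + j) = A q' ! (c + j)"
  using assms unfolding consistent_def by blast+

text \<open>A phrase \<open>(q, x, y, z, q')\<close> says that the path \<open>A q\<close> runs from \<open>x\<close> to \<open>y\<close> exactly as the path
  \<open>A q'\<close> does (no \<open>q'\<close> is needed if \<open>x = y\<close>), and then moves on to \<open>z\<close>; the convention \<open>z = y\<close>
  marks the end of the path.\<close>

definition phrase_holds :: "(nat \<times> nat) set \<Rightarrow> (nat \<times> nat \<Rightarrow> nat list) \<Rightarrow> phrase \<Rightarrow> bool" where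
  "phrase_holds Q A = (\<lambda>(q, x, y, z, q'). q \<in> Q \<and> (\<exists>a b. a \<le> b \<and> b < length (A q) \<and> A q ! a = x \<and> A q ! b = y \<and>
     z = (if Suc b < length (A q) then A q ! Suc b else y) \<and>
     (x = y \<or> (q' \<in> Q \<and> (\<exists>c d. c \<le> d \<and> d < length (A q') \<and> A q' ! c = x \<and> A q' ! d = y)))))"

text \<open>\<open>rank\<close> makes copying acyclic: a source has smaller rank and can be decoded
  first. It is not stored in the code.\<close>

definition copied ::
  "phrase set \<Rightarrow> (nat \<times> nat \<Rightarrow> nat) \<Rightarrow> (nat \<times> nat) set \<Rightarrow> (nat \<times> nat \<Rightarrow> nat list) \<Rightarrow>
   nat \<times> nat \<Rightarrow> nat \<Rightarrow> nat \<Rightarrow> nat \<Rightarrow> bool" where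
  "copied X rank Q A q a b z \<longleftrightarrow>
     (\<exists>q'. (q, A q ! a, A q ! b, z, q') \<in> X \<and> (a = b \<or> (q' \<in> Q \<and> rank q' < rank q)))"

text \<open>\<open>\<tau> k\<close> is where the \<open>k\<close>-th phrase starts. The extra vertex
  of a phrase is also the first vertex of the next one, so the copied part stops one position
  earlier. The last phrase repeats the final vertex as end marker.\<close>

definition parsed ::
  "phrase set \<Rightarrow> (nat \<times> nat \<Rightarrow> nat) \<Rightarrow> (nat \<times> nat) set \<Rightarrow> (nat \<times> nat \<Rightarrow> nat list) \<Rightarrow> nat \<times> nat \<Rightarrow> bool" where
  "parsed X rank Q A q \<longleftrightarrow> (\<exists>\<tau> r. \<tau> 0 = 0 \<and>
     (\<forall>k<r. \<tau> k < \<tau> (Suc k) \<and> \<tau> (Suc k) < length (A q) \<and>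
        copied X rank Q A q (\<tau> k) (\<tau> (Suc k) - 1) (A q ! \<tau> (Suc k))) \<and>
     \<tau> r < length (A q) \<and> copied X rank Q A q (\<tau> r) (length (A q) - 1) (A q ! (length (A q) - 1)))"

definition describes :: "phrase set \<Rightarrow> (nat \<times> nat) set \<Rightarrow> (nat \<times> nat \<Rightarrow> nat list) \<Rightarrow> bool" where
  "describes X Q A \<longleftrightarrow>
     (\<forall>q\<in>Q. A q \<noteq> [] \<and> distinct (A q) \<and> A q ! 0 = fst q) \<and> consistent Q A \<and> (\<forall>p\<in>X. phrase_holds Q A p) \<and>
     (\<exists>rank. \<forall>q\<in>Q. parsed X rank Q A q)"

text \<open>Both systems satisfy the same phrase, and its source agrees in both by
  \<open>IH\<close>. Distinctness fixes the starting position; consistency with the source fixes the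
  length and the vertices of the segment.\<close>

lemma copied_segment_determined:
  assumes d: "describes X Q A" and d': "describes X Q' A'"
    and IH: "\<And>q'. q' \<in> Q \<Longrightarrow> rank q' < rank q \<Longrightarrow> q' \<in> Q' \<Longrightarrow> A q' = A' q'"
    and q: "q \<in> Q" "q \<in> Q'"
    and ab: "a \<le> b" "b < length (A q)"
    and a: "a < length (A' q)" "A' q ! a = A q ! a"
    and cp: "copied X rank Q A q a b z"
  shows "b < length (A' q) \<and> (\<forall>j. a \<le> j \<and> j \<le> b \<longrightarrow> A' q ! j = A q ! j) \<and>
    z = (if Suc b < length (A' q) then A' q ! Suc b else A q ! b)"
proof -
  obtain q' where q': "(q, A q ! a, A q ! b, z, q') \<in> X" "a = b \<or> (q' \<in> Q \<and> rank q' < rank q)"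
    using cp by (auto simp: copied_def)
  have dist: "\<And>q. q \<in> Q \<Longrightarrow> distinct (A q)" "\<And>q. q \<in> Q' \<Longrightarrow> distinct (A' q)"
    and con: "consistent Q A" "consistent Q' A'" using d d' by (auto simp: describes_def)
  have ph: "phrase_holds Q A (q, A q ! a, A q ! b, z, q')" "phrase_holds Q' A' (q, A q ! a, A q ! b, z, q')"
    using q'(1) d d' by (auto simp: describes_def)
  obtain a' b' where ab': "a' \<le> b'" "b' < length (A' q)" "A' q ! a' = A q ! a" "A' q ! b' = A q ! b"
      "z = (if Suc b' < length (A' q) then A' q ! Suc b' else A q ! b)"
    and cd': "A q ! a = A q ! b \<or> (q' \<in> Q' \<and> (\<exists>c d. c \<le> d \<and> d < length (A' q') \<and> A' q' ! c = A q ! a \<and> A' q' ! d = A q ! b))"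
    using ph(2) by (auto simp: phrase_holds_def)
  have a': "a' = a" using ab' a dist(2)[OF q(2)] by (metis nth_eq_iff_index_eq order_le_less_trans)
  show ?thesis
  proof (cases "a = b")
    case True
    then have "b' = a" using ab' a dist(2)[OF q(2)] by (metis nth_eq_iff_index_eq)
    then show ?thesis using True ab' a by auto
  next
    case False
    then have ne: "A q ! a \<noteq> A q ! b" using ab dist(1)[OF q(1)] by (metis nth_eq_iff_index_eq order_le_less_trans)
    have qq: "q' \<in> Q" "q' \<in> Q'" "A q' = A' q'" using q'(2) False IH cd' ne by auto
    obtain c d where cd: "c \<le> d" "d < length (A q')" "A q' ! c = A q ! a" "A q' ! d = A q ! b"
      using cd' ne qq by auto
    note s = consistentD[OF con(1) q(1) qq(1) ab cd(1,2)] and s' = consistentD[OF con(2) q(2) qq(2) ab'(1,2)]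
    have 1: "b - a = d - c" "\<And>j. j \<le> b - a \<Longrightarrow> A q ! (a + j) = A q' ! (c + j)"
      using s cd by auto
    have 2: "b' - a' = d - c" "\<And>j. j \<le> b' - a' \<Longrightarrow> A' q ! (a' + j) = A' q' ! (c + j)"
      using s'[of c d] cd ab' qq(3) by auto
    have b: "b' = b" using 1 2 a' ab ab' by simp
    have "A' q ! j = A q ! j" if "a \<le> j" "j \<le> b" for j
      using 1(2)[of "j - a"] 2(2)[of "j - a"] that a' b qq(3) by simp
    then show ?thesis using b ab' by auto
  qed
qed

text \<open>Every path contributes at least its last phrase, and a phrase that holds names a member
  of the domain.\<close>

lemma describes_imp_same_domain:
  assumes "describes X Q A" "describes X Q' A'"
  shows "Q \<subseteq> Q'"
proof
  fix q assume "q \<in> Q"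
  then obtain x y z q' where "(q, x, y, z, q') \<in> X"
    using assms(1) unfolding describes_def parsed_def copied_def by blast
  then show "q \<in> Q'" using assms(2) unfolding describes_def phrase_holds_def by blast
qed

text \<open>Decoding is unique, by an outer induction on the rank and an inner one along the phrases
  of a path from left to right.\<close>

lemma describes_determines:
  assumes d: "describes X Q A" and d': "describes X Q' A'"
  shows "Q = Q'" "\<And>q. q \<in> Q \<Longrightarrow> A q = A' q"
proof -
  show Q: "Q = Q'" using describes_imp_same_domain[OF d d'] describes_imp_same_domain[OF d' d] by blast
  obtain rank where rank: "\<And>q. q \<in> Q \<Longrightarrow> parsed X rank Q A q"
    using d unfolding describes_def by blast
  show "A q = A' q" if "q \<in> Q" for q
    using that
  proof (induction "rank q" arbitrary: q rule: less_induct)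
    case less
    obtain \<tau> r where \<tau>: "\<tau> 0 = 0" and step: "\<And>k. k < r \<Longrightarrow> \<tau> k < \<tau> (Suc k) \<and> \<tau> (Suc k) < length (A q) \<and>
           copied X rank Q A q (\<tau> k) (\<tau> (Suc k) - 1) (A q ! \<tau> (Suc k))"
      and last: "\<tau> r < length (A q)" "copied X rank Q A q (\<tau> r) (length (A q) - 1) (A q ! (length (A q) - 1))"
      using rank[OF less.prems] unfolding parsed_def by blast
    have q': "q \<in> Q'" using less.prems Q by simp
    have dist: "distinct (A q)" "distinct (A' q)" "A q \<noteq> []" "A' q \<noteq> []" "A q ! 0 = A' q ! 0"
      using d d' less.prems q' by (auto simp: describes_def)
    note seg = copied_segment_determined[OF d d' less.hyps less.prems q']
    have pre: "\<tau> k < length (A' q) \<and> (\<forall>j\<le>\<tau> k. A' q ! j = A q ! j)" if "k \<le> r" for k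
      using that
    proof (induction k)
      case 0
      then show ?case using \<tau> dist by simp
    next
      case (Suc k)
      then have st: "\<tau> k < \<tau> (Suc k)" "\<tau> (Suc k) < length (A q)"
        "copied X rank Q A q (\<tau> k) (\<tau> (Suc k) - 1) (A q ! \<tau> (Suc k))"
        and IH: "\<tau> k < length (A' q)" "\<And>j. j \<le> \<tau> k \<Longrightarrow> A' q ! j = A q ! j" using step[of k] by auto
      have *: "\<tau> (Suc k) - 1 < length (A' q)"
          "\<And>j. \<tau> k \<le> j \<Longrightarrow> j \<le> \<tau> (Suc k) - 1 \<Longrightarrow> A' q ! j = A q ! j"
          "A q ! \<tau> (Suc k) = (if Suc (\<tau> (Suc k) - 1) < length (A' q) then A' q ! Suc (\<tau> (Suc k) - 1) else A q ! (\<tau> (Suc k) - 1))"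
        using seg[OF _ _ _ _ IH(1) _ st(3)] st IH(2)[of "\<tau> k"] by auto
      \<comment> \<open>The extra vertex differs from the end of the copied part, so it is no end
        marker and \<open>A' q\<close> has to continue with it.\<close>
      have "A q ! \<tau> (Suc k) \<noteq> A q ! (\<tau> (Suc k) - 1)" using dist(1) st by (simp add: nth_eq_iff_index_eq)
      then have "\<tau> (Suc k) < length (A' q)" "A' q ! \<tau> (Suc k) = A q ! \<tau> (Suc k)"
        using *(3) st(1) by (auto split: if_splits)
      moreover have "A' q ! j = A q ! j" if "j < \<tau> (Suc k)" for j
        using IH(2)[of j] *(2)[of j] that by linarith
      ultimately show ?case by (metis le_neq_implies_less)
    qed
    let ?l = "length (A q) - 1"
    have *: "?l < length (A' q)" "\<And>j. \<tau> r \<le> j \<Longrightarrow> j \<le> ?l \<Longrightarrow> A' q ! j = A q ! j"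
        "A q ! ?l = (if Suc ?l < length (A' q) then A' q ! Suc ?l else A q ! ?l)"
      using seg[OF _ _ _ _ _ _ last(2)] pre[of r] last(1) by auto
    have eq: "A' q ! j = A q ! j" if "j < length (A q)" for j
      using pre[of r] *(2)[of j] that by (cases "j \<le> \<tau> r") auto
    \<comment> \<open>Conversely, after the end marker a continuation of \<open>A' q\<close> would
      repeat a vertex.\<close>
    have "\<not> Suc ?l < length (A' q)"
    proof
      assume l: "Suc ?l < length (A' q)"
      then have "A' q ! ?l = A' q ! Suc ?l" using *(3) eq[of ?l] dist(3) by simp
      then show False using l dist(2) by (simp add: nth_eq_iff_index_eq)
    qed
    then have "length (A q) = length (A' q)" using *(1) dist(3) by (simp add: not_less)
    then show ?case using eq by (intro nth_equalityI) auto
  qed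
qed

text \<open>From the current position \<open>a\<close>, move to the first \<open>b\<close> for which
  the segment from \<open>a\<close> to \<open>b\<close> is not old, until the rest is old.\<close>

lemma greedy_tiling:
  fixes old :: "nat \<Rightarrow> nat \<Rightarrow> bool"
  assumes "a \<le> N" "\<And>i. old i i"
  shows "\<exists>\<tau> r. \<tau> 0 = a \<and> (\<forall>k<r. \<tau> k < \<tau> (Suc k) \<and> \<tau> (Suc k) \<le> N \<and> \<not> old (\<tau> k) (\<tau> (Suc k)) \<and>
     old (\<tau> k) (\<tau> (Suc k) - 1)) \<and> \<tau> r \<le> N \<and> old (\<tau> r) N"
  using assms(1)
proof (induction "N - a" arbitrary: a rule: less_induct)
  case less
  show ?case
  proof (cases "old a N")
    case True
    then show ?thesis using less.prems by (intro exI[of _ "\<lambda>_. a"] exI[of _ 0]) auto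
  next
    case False
    define b where "b = (LEAST b. a < b \<and> \<not> old a b)"
    have aN: "a < N" using False assms(2) less.prems by (metis le_neq_implies_less)
    have b: "a < b" "\<not> old a b" and bN: "b \<le> N"
      unfolding b_def using LeastI[of "\<lambda>b. a < b \<and> \<not> old a b" N] Least_le[of "\<lambda>b. a < b \<and> \<not> old a b" N] aN False by auto
    \<comment> \<open>By minimality of \<open>b\<close>, or by reflexivity if \<open>b\<close> is
      the successor of \<open>a\<close>.\<close>
    have o: "old a (b - 1)"
    proof (cases "b - 1 = a")
      case False
      then show ?thesis using not_less_Least[of "b - 1" "\<lambda>b. a < b \<and> \<not> old a b"] b(1) b_def by auto
    qed (use assms in simp)
    have "N - b < N - a" using b bN by auto
    from less.hyps[OF this bN]
    obtain \<tau> r where \<tau>: "\<tau> 0 = b" "\<forall>k<r. \<tau> k < \<tau> (Suc k) \<and> \<tau> (Suc k) \<le> N \<and> \<not> old (\<tau> k) (\<tau> (Suc k)) \<and>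
     old (\<tau> k) (\<tau> (Suc k) - 1)" "\<tau> r \<le> N" "old (\<tau> r) N"
      by blast
    show ?thesis
    proof (intro exI conjI allI impI)
      let ?\<tau> = "case_nat a \<tau>"
      show "?\<tau> 0 = a" "?\<tau> (Suc r) \<le> N" "old (?\<tau> (Suc r)) N" using \<tau> by auto
      fix k assume "k < Suc r"
      then show "?\<tau> k < ?\<tau> (Suc k)" "?\<tau> (Suc k) \<le> N" "\<not> old (?\<tau> k) (?\<tau> (Suc k))" "old (?\<tau> k) (?\<tau> (Suc k) - 1)"
        using \<tau> b bN o by (cases k; simp)+
    qed
  qed
qed

section \<open>Greedy parsing of a system of shortest paths\<close>

context unique_shortest
begin

lemma D_additive:
  assumes "shortest E w s t \<pi>" "s < n" "a \<le> b" "b < length \<pi>"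
  shows "D (s, \<pi> ! a) + D (\<pi> ! a, \<pi> ! b) = D (s, \<pi> ! b)"
proof -
  have an: "\<pi> ! a < n" using shortest_in_range[OF assms(1,2)] assms(3,4) nth_mem[of a \<pi>] by fastforce
  have D0: "D (s, \<pi> ! i) = path_weight w (take (Suc i) \<pi>)" if "i < length \<pi>" for i
    using shortest_imp_sp[OF assms(2) shortest_take[OF assms(1) that]] by (simp add: D_def)
  have Dab: "D (\<pi> ! a, \<pi> ! b) = path_weight w (take (Suc (b - a)) (drop a \<pi>))"
    using shortest_imp_sp[OF an shortest_segment[OF assms(1,3,4)]] by (simp add: D_def)
  have p: "is_path E s (\<pi> ! b) (take (Suc b) \<pi>)" using shortest_take[OF assms(1,4)] by (simp add: shortest_def)
  have "path_weight w (take (Suc b) \<pi>) =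
      path_weight w (take (Suc a) (take (Suc b) \<pi>)) + path_weight w (drop a (take (Suc b) \<pi>))"
    by (rule path_weight_take_drop[OF p]) (use assms in auto)
  moreover have "take (Suc a) (take (Suc b) \<pi>) = take (Suc a) \<pi>" using assms(3) by (simp add: min_def)
  moreover have "drop a (take (Suc b) \<pi>) = take (Suc (b - a)) (drop a \<pi>)"
    using assms(3) by (simp add: drop_take Suc_diff_le)
  ultimately show ?thesis using D0[of a] D0[of b] Dab assms(3,4) by simp
qed

lemma shortest_reach:
  assumes "shortest E w s t \<pi>" "s < n" "a \<le> b" "b < length \<pi>"
  shows "(\<pi> ! a, \<pi> ! b) \<in> reach"
proof -
  have "\<pi> ! a < n" "\<pi> ! b < n"
    using shortest_in_range[OF assms(1,2)] assms(3,4) nth_mem[of a \<pi>] nth_mem[of b \<pi>] by fastforce+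
  then show ?thesis using shortest_segment[OF assms(1,3,4)] by (auto simp: reach_def shortest_def)
qed

end

section \<open>Greedy phrases of the demand paths and the graph they span\<close>

locale demand_paths = unique_shortest +
  fixes Q :: "(nat \<times> nat) set"
  assumes Q: "Q \<subseteq> reach"
begin

definition A :: "nat \<times> nat \<Rightarrow> nat list" where
  "A q = sp (fst q) (snd q)"

lemma A_shortest: "q \<in> Q \<Longrightarrow> shortest E w (fst q) (snd q) (A q)"
  unfolding A_def using Q by (intro shortest_sp) auto

lemma fst_less: "q \<in> Q \<Longrightarrow> fst q < n"
  using Q by (auto simp: reach_def)

lemma A_distinct: "q \<in> Q \<Longrightarrow> distinct (A q)"
  using shortest_distinct[OF A_shortest pos] by blast

lemma A_ends:
  assumes "q \<in> Q"
  shows "A q ! 0 = fst q" "0 < length (A q)"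
  using is_path_ends[of E "fst q" "snd q" "A q"] A_shortest[OF assms] by (auto simp: shortest_def)

lemma A_nth_less: "q \<in> Q \<Longrightarrow> i < length (A q) \<Longrightarrow> A q ! i < n"
  using shortest_in_range[OF A_shortest fst_less] nth_mem[of i "A q"] by fastforce

lemma A_nth_inj: "q \<in> Q \<Longrightarrow> i < length (A q) \<Longrightarrow> j < length (A q) \<Longrightarrow> A q ! i = A q ! j \<longleftrightarrow> i = j"
  using A_distinct by (simp add: nth_eq_iff_index_eq)

lemma A_length_le: "q \<in> Q \<Longrightarrow> length (A q) \<le> n"
  using card_mono[OF _ shortest_in_range[OF A_shortest fst_less], of q] distinct_card[OF A_distinct, of q] by simp

lemma A_consistent: "consistent Q A"
  unfolding consistent_def using shortest_segments_agree[OF A_shortest A_shortest fst_less] by blast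

text \<open>The paths are processed in the order of \<open>prod_encode\<close>. \<open>Id\<close>
  makes one-vertex segments old, as the greedy parsing requires.\<close>

definition seen :: "nat \<times> nat \<Rightarrow> (nat \<times> nat) set" where
  "seen q = Id \<union> {(A q' ! a, A q' ! b) | q' a b. q' \<in> Q \<and> prod_encode q' < prod_encode q \<and> a \<le> b \<and> b < length (A q')}"

abbreviation old :: "nat \<times> nat \<Rightarrow> nat \<Rightarrow> nat \<Rightarrow> bool" where
  "old q a b \<equiv> (A q ! a, A q ! b) \<in> seen q"

text \<open>By consistency the earlier path contains the whole segment and not only its
  ends.\<close>

lemma old_subsegment:
  assumes q: "q \<in> Q" and o: "old q a b" and le: "a \<le> a'" "a' \<le> b'" "b' \<le> b" "b < length (A q)"
  shows "old q a' b'"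
proof (cases "a = b")
  case True
  then have "a' = b'" using le by simp
  then show ?thesis by (simp add: seen_def)
next
  case False
  then have "A q ! a \<noteq> A q ! b" using A_nth_inj[OF q] le by auto
  then obtain q' c d where *: "q' \<in> Q" "prod_encode q' < prod_encode q" "c \<le> d" "d < length (A q')"
    "A q ! a = A q' ! c" "A q ! b = A q' ! d" using o by (auto simp: seen_def)
  have ab: "a \<le> b" using le by simp
  note c = consistentD[OF A_consistent q *(1) ab le(4) *(3,4,5,6)]
  have "A q ! a' = A q' ! (c + (a' - a))" "A q ! b' = A q' ! (c + (b' - a))"
    using c(2)[of "a' - a"] c(2)[of "b' - a"] le by auto
  moreover have "c + (a' - a) \<le> c + (b' - a)" "c + (b' - a) < length (A q')" using c(1) le * by auto
  ultimately show ?thesis using *(1,2) unfolding seen_def by blast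
qed

definition tiling :: "nat \<times> nat \<Rightarrow> (nat \<Rightarrow> nat) \<Rightarrow> nat \<Rightarrow> bool" where
  "tiling q \<tau> r \<longleftrightarrow> \<tau> 0 = 0 \<and> (\<forall>k<r. \<tau> k < \<tau> (Suc k) \<and> \<tau> (Suc k) \<le> length (A q) - 1 \<and> \<not> old q (\<tau> k) (\<tau> (Suc k)) \<and>
     old q (\<tau> k) (\<tau> (Suc k) - 1)) \<and> \<tau> r \<le> length (A q) - 1 \<and> old q (\<tau> r) (length (A q) - 1)"

lemma tiling_exists: "\<exists>\<tau> r. tiling q \<tau> r"
  using greedy_tiling[of 0 "length (A q) - 1" "old q"] by (auto simp: tiling_def seen_def)

definition tau :: "nat \<times> nat \<Rightarrow> nat \<Rightarrow> nat" where
  "tau q = (SOME \<tau>. \<exists>r. tiling q \<tau> r)"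

definition tiles :: "nat \<times> nat \<Rightarrow> nat" where
  "tiles q = (SOME r. tiling q (tau q) r)"

lemma tiling_tau: "tiling q (tau q) (tiles q)"
  unfolding tau_def tiles_def using tiling_exists by (metis (mono_tags, lifting) someI_ex)

lemma tau_0: "tau q 0 = 0"
  using tiling_tau by (simp add: tiling_def)

lemma tau_step:
  assumes "k < tiles q"
  shows "tau q k < tau q (Suc k)" "\<not> old q (tau q k) (tau q (Suc k))" "old q (tau q k) (tau q (Suc k) - 1)"
  using tiling_tau[of q] assms by (auto simp: tiling_def)

lemma tau_end: "old q (tau q (tiles q)) (length (A q) - 1)"
  using tiling_tau by (simp add: tiling_def)

lemma tau_less_length:
  assumes "q \<in> Q" "k \<le> tiles q"
  shows "tau q k < length (A q)"
proof (cases k)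
  case 0
  then show ?thesis using tau_0 A_ends[OF assms(1)] by simp
next
  case (Suc j)
  then have "tau q k \<le> length (A q) - 1" using tiling_tau[of q] assms by (auto simp: tiling_def)
  then show ?thesis using A_ends(2)[OF assms(1)] by linarith
qed

lemma tau_strict_mono: "k < l \<Longrightarrow> l \<le> tiles q \<Longrightarrow> tau q k < tau q l"
proof (induction l)
  case (Suc l)
  then show ?case using tau_step(1)[of l q] by (cases "k = l") auto
qed simp

lemma tau_less_iff: "k \<le> tiles q \<Longrightarrow> l \<le> tiles q \<Longrightarrow> tau q k < tau q l \<longleftrightarrow> k < l"
  using tau_strict_mono by (metis less_asym' linorder_neqE_nat)

lemma tau_le_iff: "k \<le> tiles q \<Longrightarrow> l \<le> tiles q \<Longrightarrow> tau q k \<le> tau q l \<longleftrightarrow> k \<le> l"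
  using tau_less_iff by (metis not_less)

lemma tiles_less: "q \<in> Q \<Longrightarrow> tiles q < n"
proof -
  assume q: "q \<in> Q"
  have "k \<le> tiles q \<Longrightarrow> k \<le> tau q k" for k
  proof (induction k)
    case (Suc k)
    then show ?case using tau_step(1)[of k q] by simp
  qed simp
  from this[of "tiles q"] show "tiles q < n" using tau_less_length[OF q, of "tiles q"] A_length_le[OF q] by simp
qed

definition tile :: "(nat \<times> nat) \<times> nat \<Rightarrow> nat \<times> nat" where
  "tile = (\<lambda>(q, k). (A q ! tau q k, A q ! tau q (Suc k)))"

definition tile_index :: "((nat \<times> nat) \<times> nat) set" where
  "tile_index = (SIGMA q : Q. {..<tiles q})"

text \<open>Each tile joins the start of a phrase to the start of the next one. The last phrase of a
  path has no tile; these phrases account for the summand \<open>card Q\<close> later on.\<close>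

definition \<Phi> :: "(nat \<times> nat) set" where
  "\<Phi> = tile ` tile_index"

lemma tile_seen_later:
  assumes "q \<in> Q" "prod_encode q < prod_encode q'" "a \<le> b" "b < length (A q)"
  shows "(A q ! a, A q ! b) \<in> seen q'"
  using assms unfolding seen_def by blast

text \<open>A tile of an earlier path is seen by every later path, whereas a tile of the later path
  is not. Within one path the starting vertex determines the index.\<close>

lemma inj_on_tile: "inj_on tile tile_index"
proof (rule inj_onI)
  have lt: False if "(q, k) \<in> tile_index" "(q', k') \<in> tile_index" "tile (q, k) = tile (q', k')"
    "prod_encode q < prod_encode q'" for q k q' k'
  proof -
    have "q \<in> Q" "k < tiles q" "k' < tiles q'" using that by (auto simp: tile_index_def)
    then have "tile (q, k) \<in> seen q'"
      using tile_seen_later[OF _ that(4), of "tau q k" "tau q (Suc k)"] tau_step(1)[of k q] tau_less_length[of q "Suc k"]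
      by (simp add: tile_def)
    then show False using that(3) tau_step(2)[OF \<open>k' < tiles q'\<close>] by (simp add: tile_def)
  qed
  fix x y assume xy: "x \<in> tile_index" "y \<in> tile_index" "tile x = tile y"
  obtain q k q' k' where e: "x = (q, k)" "y = (q', k')" by (cases x, cases y)
  have "q = q'" using lt[of q k q' k'] lt[of q' k' q k] xy e
    by (metis linorder_neqE_nat prod_encode_eq)
  moreover have "k = k'"
  proof -
    have k: "q \<in> Q" "k < tiles q" "k' < tiles q" using xy e \<open>q = q'\<close> by (auto simp: tile_index_def)
    have "tau q k = tau q k'"
      using xy(3) e \<open>q = q'\<close> A_nth_inj[OF k(1)] tau_less_length[OF k(1), of k] tau_less_length[OF k(1), of k'] k
      by (simp add: tile_def)
    then show ?thesis using tau_le_iff[of k q k'] tau_le_iff[of k' q k] k by (simp add: order_antisym)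
  qed
  ultimately show "x = y" using e by simp
qed

lemma \<Phi>_reach: "\<Phi> \<subseteq> reach"
proof
  fix e assume "e \<in> \<Phi>"
  then obtain q k where e: "e = tile (q, k)" "q \<in> Q" "k < tiles q" by (auto simp: \<Phi>_def tile_index_def)
  then show "e \<in> reach"
    using shortest_reach[OF A_shortest fst_less, of q "tau q k" "tau q (Suc k)"] tau_step(1)[of k q] tau_less_length[of q "Suc k"]
    by (simp add: tile_def)
qed

text \<open>No hop overtakes the greedy tiling. A tile of \<open>q\<close> itself is compared by
  index; a tile of an earlier path is old and cannot cover a greedy tile of \<open>q\<close>; a tile
  of a later path cannot occur, as it would have been seen on \<open>q\<close>.\<close>

lemma \<Phi>_hop:
  assumes q: "q \<in> Q" and i: "i < tiles q" and uv: "u \<le> v" "v < length (A q)" and e: "(A q ! u, A q ! v) \<in> \<Phi>"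
    and u: "u \<le> tau q i"
  shows "v \<le> tau q (Suc i) \<and> (v = tau q (Suc i) \<longrightarrow> u = tau q i)"
proof -
  obtain q' l where l: "q' \<in> Q" "l < tiles q'" "A q ! u = A q' ! tau q' l" "A q ! v = A q' ! tau q' (Suc l)"
    using e by (auto simp: \<Phi>_def tile_index_def tile_def)
  have t: "tau q' l < tau q' (Suc l)" "tau q' (Suc l) < length (A q')"
    using tau_step(1) tau_less_length l by auto
  consider "q' = q" | "prod_encode q' < prod_encode q" | "prod_encode q < prod_encode q'"
    by (metis linorder_neqE_nat prod_encode_eq)
  then show ?thesis
  proof cases
    case 1
    then have "u = tau q l" "v = tau q (Suc l)" using l t A_nth_inj[OF q] uv by auto
    then show ?thesis using u i l 1 tau_le_iff[of l q i] tau_le_iff[of "Suc l" q "Suc i"] tau_le_iff[of "Suc i" q "Suc l"] by auto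
  next
    case 2
    then have "old q u v" using tile_seen_later[OF l(1) 2, of "tau q' l" "tau q' (Suc l)"] l t by simp
    then have "v < tau q (Suc i)"
      using old_subsegment[OF q _ u _ _ uv(2)] tau_step(1,2)[OF i] by (meson less_imp_le not_less)
    then show ?thesis by simp
  next
    case 3
    then have "tile (q', l) \<in> seen q'" using tile_seen_later[OF q 3 uv] l by (simp add: tile_def)
    then show ?thesis using tau_step(2)[OF l(2)] by (simp add: tile_def)
  qed
qed

text \<open>Every edge of \<open>\<Phi>\<close> is forced. The extra cost \<open>\<epsilon>\<close> per edge makes a cheapest walk minimise the
  number of hops among the tilings of a path, and the greedy tiling stays strictly ahead of any other one.\<close>

lemma tight_\<Phi>_path_uses_tiles:
  assumes q: "q \<in> Q" and \<rho>: "is_path \<Phi> (fst q) (A q ! tau q (tiles q)) \<rho>" and len: "length \<rho> - 1 \<le> tiles q"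
    and tight: "path_weight D \<rho> = D (fst q, A q ! tau q (tiles q))" and k: "k < tiles q"
  shows "tile (q, k) \<in> set (path_edges \<rho>)"
proof -
  let ?h = "length \<rho> - 1"
  have "is_path reach (fst q) (A q ! tau q (tiles q)) \<rho>" by (rule is_path_mono[OF \<rho> \<Phi>_reach])
  from tight_reach_path_positions[OF this A_shortest[OF q] fst_less[OF q] tau_less_length[OF q order_refl] tight]
  obtain c where c: "c 0 = (0::nat)" "c ?h = tau q (tiles q)" "\<And>k. Suc k < length \<rho> \<Longrightarrow> c k \<le> c (Suc k)"
    "\<And>k. k < length \<rho> \<Longrightarrow> c k < length (A q) \<and> A q ! c k = \<rho> ! k" by blast
  have l0: "0 < length \<rho>" using is_path_ends[OF \<rho>] by blast
  have hop: "c (Suc k) \<le> tau q (Suc k) \<and> (c (Suc k) = tau q (Suc k) \<longrightarrow> c k = tau q k)"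
    if "k < ?h" "c k \<le> tau q k" for k
  proof -
    have k: "Suc k < length \<rho>" "k < tiles q" using that len by auto
    have "(\<rho> ! k, \<rho> ! Suc k) \<in> \<Phi>" using \<rho> k(1) by (simp add: is_path_def)
    then show ?thesis using \<Phi>_hop[OF q k(2) c(3)[OF k(1)] _ _ that(2)] c(4)[of k] c(4)[of "Suc k"] k by simp
  qed
  \<comment> \<open>Going forward, the walk never gets ahead of the greedy tiling, so it needs at
    least \<open>tiles q\<close> hops.\<close>
  have le: "k \<le> ?h \<Longrightarrow> c k \<le> tau q k" for k
  proof (induction k)
    case (Suc k)
    then show ?case using hop[of k] by simp
  qed (simp add: c(1))
  have h: "?h = tiles q" using le[of ?h] c(2) len tau_le_iff[of "tiles q" q ?h] by simp
  \<comment> \<open>Going backward from the common end, the equality case of \<open>hop\<close>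
    makes all positions coincide.\<close>
  have eq: "c (?h - j) = tau q (?h - j)" for j
  proof (induction j)
    case 0
    then show ?case using c(2) h by simp
  next
    case (Suc j)
    show ?case
    proof (cases "j < ?h")
      case True
      then have "Suc (?h - Suc j) = ?h - j" "?h - Suc j < ?h" by auto
      then show ?thesis using hop[of "?h - Suc j"] le[of "?h - Suc j"] Suc by simp
    next
      case False
      then show ?thesis using Suc by simp
    qed
  qed
  have "c k = tau q k" "c (Suc k) = tau q (Suc k)" using eq[of "?h - k"] eq[of "?h - Suc k"] k h by auto
  then have "tile (q, k) = (\<rho> ! k, \<rho> ! Suc k)" using c(4)[of k] c(4)[of "Suc k"] k h l0 by (simp add: tile_def)
  then show ?thesis using k h by (auto simp: path_edges_conv_nth)
qed

lemma greedy_\<Phi>_path: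
  assumes q: "q \<in> Q" and "l \<le> tiles q"
  shows "\<exists>\<rho>. is_path \<Phi> (fst q) (A q ! tau q l) \<rho> \<and> path_weight D \<rho> = D (fst q, A q ! tau q l) \<and> length \<rho> = Suc l"
  using assms(2)
proof (induction l)
  case 0
  have "D (fst q, A q ! 0) + D (A q ! 0, A q ! 0) = D (fst q, A q ! 0)"
    using D_additive[OF A_shortest[OF q] fst_less[OF q], of 0 0] A_ends[OF q] by simp
  then show ?case using A_ends[OF q] by (intro exI[of _ "[fst q]"]) (simp add: tau_0)
next
  case (Suc l)
  then obtain \<rho> where \<rho>: "is_path \<Phi> (fst q) (A q ! tau q l) \<rho>" "path_weight D \<rho> = D (fst q, A q ! tau q l)"
    "length \<rho> = Suc l" by auto
  have l: "l < tiles q" using Suc by simp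
  have "tile (q, l) \<in> \<Phi>" using q l by (auto simp: \<Phi>_def tile_index_def)
  then have e: "is_path \<Phi> (A q ! tau q l) (A q ! tau q (Suc l)) [A q ! tau q l, A q ! tau q (Suc l)]"
    by (simp add: tile_def)
  have "D (fst q, A q ! tau q l) + D (A q ! tau q l, A q ! tau q (Suc l)) = D (fst q, A q ! tau q (Suc l))"
    using D_additive[OF A_shortest[OF q] fst_less[OF q], of "tau q l" "tau q (Suc l)"] tau_step(1)[OF l]
      tau_less_length[OF q, of "Suc l"] l by simp
  then show ?case using is_path_join[OF \<rho>(1) e] path_weight_join[OF \<rho>(1) e, of D] \<rho>(2,3)
    by (intro exI[of _ "\<rho> @ [A q ! tau q (Suc l)]"]) simp
qed

lemma D_nonneg: "e \<in> reach \<Longrightarrow> 0 \<le> D e"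
  using shortest_sp[of "fst e" "snd e"] path_weight_nonneg[of E _ _ _ w] G
  by (auto simp: D_def shortest_def wgraph_def)

text \<open>The bound \<open>M\<close> on preservers is applied to \<open>\<Phi>\<close> with the
  weights \<open>W\<close>: no tile can be missing from a preserver, so \<open>M\<close> bounds
  their number.\<close>

lemma tile_count_le:
  assumes finQ: "finite Q" and cQ: "card Q \<le> p" and pn: "p \<le> card ({0..<n} \<times> {0..<n})"
    and M: "\<And>E w P. wgraph n E w \<Longrightarrow> P \<subseteq> {0..<n} \<times> {0..<n} \<Longrightarrow> card P = p \<Longrightarrow> \<exists>H. dist_preserver E w P H \<and> card H \<le> M"
  shows "card tile_index \<le> M"
proof -
  let ?V = "{0..<n}"
  \<comment> \<open>A walk with at most \<open>tiles q\<close> hops has at most \<open>n\<close>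
    vertices, so finitely many lists suffice for the gap.\<close>
  let ?S = "(\<lambda>(\<rho>, x, y). path_weight D \<rho> - D (x, y)) ` ({\<rho>. set \<rho> \<subseteq> ?V \<and> length \<rho> \<le> n} \<times> ?V \<times> ?V)"
  have "finite ?S" by (intro finite_imageI finite_cartesian_product finite_lists_length_le) auto
  from finite_positive_gap[OF this]
  obtain \<gamma> where \<gamma>: "\<gamma> > 0" "\<forall>x\<in>?S. 0 < x \<longrightarrow> \<gamma> \<le> x" by blast
  \<comment> \<open>\<open>n\<close> hops of extra cost together stay within the gap; the case
    \<open>n = 0\<close> only keeps \<open>\<epsilon>\<close> positive.\<close>
  define \<epsilon> where "\<epsilon> = (if n = 0 then 1 else \<gamma> / real n)"
  have \<epsilon>: "\<epsilon> > 0" using \<gamma>(1) by (simp add: \<epsilon>_def)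
  have gap: "D (x, y) + real n * \<epsilon> \<le> path_weight D \<rho>"
    if "set \<rho> \<subseteq> ?V" "length \<rho> \<le> n" "x < n" "y < n" "D (x, y) < path_weight D \<rho>" for \<rho> x y
  proof -
    have "path_weight D \<rho> - D (x, y) \<in> ?S" using that by (intro image_eqI[of _ _ "(\<rho>, x, y)"]) auto
    then have "\<gamma> \<le> path_weight D \<rho> - D (x, y)" using \<gamma>(2) that(5) by auto
    then show ?thesis using that(3) by (simp add: \<epsilon>_def)
  qed
  define W where "W = (\<lambda>e. D e + \<epsilon> * 1)"
  have W: "path_weight W \<rho> = path_weight D \<rho> + \<epsilon> * real (length \<rho> - 1)" for \<rho>
    unfolding W_def path_weight_add_scaled by (simp add: path_weight_def)
  have \<Phi>V: "\<Phi> \<subseteq> ?V \<times> ?V" using \<Phi>_reach by (auto simp: reach_def)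
  have G\<Phi>: "wgraph n \<Phi> W"
    unfolding wgraph_def W_def using \<Phi>V D_nonneg \<Phi>_reach \<epsilon> by (auto intro!: add_nonneg_nonneg)
  \<comment> \<open>The demands end where the last phrase starts. Different paths may yield the same
    pair, so the set is padded to exactly \<open>p\<close> pairs.\<close>
  let ?P = "(\<lambda>q. (fst q, A q ! tau q (tiles q))) ` Q"
  have "?P \<subseteq> ?V \<times> ?V" using fst_less A_nth_less tau_less_length by auto
  moreover have "card ?P \<le> p" using card_image_le[OF finQ] cQ order_trans by blast
  ultimately obtain P' where P': "?P \<subseteq> P'" "P' \<subseteq> ?V \<times> ?V" "card P' = p"
    using exists_subset_between[of ?P p "?V \<times> ?V"] pn by blast
  obtain H where H: "dist_preserver \<Phi> W P' H" "card H \<le> M" using M[OF G\<Phi> P'(2,3)] by blast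
  have H\<Phi>: "H \<subseteq> \<Phi>" using H(1) by (simp add: dist_preserver_def)
  have "tile (q, k) \<in> H" if q: "q \<in> Q" and k: "k < tiles q" for q k
  proof (rule ccontr)
    assume no: "tile (q, k) \<notin> H"
    define s t r where "s = fst q" and "t = A q ! tau q (tiles q)" and "r = tiles q"
    have st: "(s, t) \<in> reach" unfolding s_def t_def
      using shortest_reach[OF A_shortest[OF q] fst_less[OF q], of 0 "tau q (tiles q)"] tau_less_length[OF q] A_ends[OF q] by simp
    have stn: "s < n" "t < n" using st by (auto simp: reach_def)
    have "gdist H W s t = gdist \<Phi> W s t"
      using H(1) P'(1) q unfolding dist_preserver_def s_def t_def by blast
    also have "\<dots> \<le> ereal (D (s, t) + \<epsilon> * real r)"
    proof -
      obtain \<rho> where "is_path \<Phi> s t \<rho>" "path_weight D \<rho> = D (s, t)" "length \<rho> = Suc r"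
        using greedy_\<Phi>_path[OF q order_refl] unfolding s_def t_def r_def by blast
      then show ?thesis using gdist_le[of \<Phi> s t \<rho> W] W[of \<rho>] by simp
    qed
    finally have up: "gdist H W s t \<le> ereal (D (s, t) + \<epsilon> * real r)" .
    \<comment> \<open>Without the tile, a walk either has more than \<open>r\<close> hops or is not
      tight; it then pays at least one more \<open>\<epsilon>\<close> for a hop, or the whole
      gap.\<close>
    have "ereal (D (s, t) + \<epsilon> * real (Suc r)) \<le> gdist H W s t"
    proof (rule gdist_ge)
      fix \<rho> assume \<rho>: "is_path H s t \<rho>"
      have \<rho>\<Phi>: "is_path \<Phi> s t \<rho>" by (rule is_path_mono[OF \<rho> H\<Phi>])
      have \<rho>r: "is_path reach s t \<rho>" by (rule is_path_mono[OF \<rho>\<Phi> \<Phi>_reach])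
      have ge: "D (s, t) \<le> path_weight D \<rho>" by (rule D_le_reach_path[OF \<rho>r st])
      have "D (s, t) + \<epsilon> * real (Suc r) \<le> path_weight W \<rho>"
      proof (cases "length \<rho> - 1 \<le> r")
        case False
        then have "real (Suc r) \<le> real (length \<rho> - 1)" by linarith
        then show ?thesis using ge \<epsilon> unfolding W by (intro add_mono mult_left_mono) auto
      next
        case True
        have "path_weight D \<rho> \<noteq> D (s, t)"
        proof
          assume "path_weight D \<rho> = D (s, t)"
          then have "tile (q, k) \<in> set (path_edges \<rho>)"
            using tight_\<Phi>_path_uses_tiles[OF q _ _ _ k] \<rho>\<Phi> True unfolding s_def t_def r_def by blast
          then show False using no \<rho> by (auto simp: is_path_iff)
        qed
        then have lt: "D (s, t) < path_weight D \<rho>" using ge by simp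
        have "set \<rho> \<subseteq> ?V" using is_path_set[OF \<rho>\<Phi> \<Phi>V] stn by simp
        moreover have rn: "r < n" unfolding r_def by (rule tiles_less[OF q])
        moreover have "length \<rho> \<le> n" using True rn by linarith
        ultimately have "D (s, t) + real n * \<epsilon> \<le> path_weight D \<rho>" using gap[of \<rho> s t] stn lt by blast
        moreover have "\<epsilon> * real (Suc r) \<le> real n * \<epsilon>" using rn \<epsilon> by simp
        moreover have "0 \<le> \<epsilon> * real (length \<rho> - 1)" using \<epsilon> by simp
        ultimately show ?thesis unfolding W by linarith
      qed
      then show "ereal (D (s, t) + \<epsilon> * real (Suc r)) \<le> ereal (path_weight W \<rho>)" by simp
    qed
    then have "ereal (D (s, t) + \<epsilon> * real (Suc r)) \<le> ereal (D (s, t) + \<epsilon> * real r)" using up by (rule order_trans)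
    then show False using \<epsilon> by (simp add: algebra_simps)
  qed
  then have "tile ` tile_index \<subseteq> H" by (auto simp: tile_index_def)
  moreover have "finite H" by (rule finite_subset[OF subset_trans[OF H\<Phi> \<Phi>V]]) simp
  ultimately have "card (tile ` tile_index) \<le> card H" by (intro card_mono)
  then show ?thesis using card_image[OF inj_on_tile] H(2) by simp
qed

section \<open>The code of the demand paths\<close>

definition source :: "nat \<times> nat \<Rightarrow> nat \<Rightarrow> nat \<Rightarrow> nat \<times> nat" where
  "source q a b = (if a = b then q else SOME q'. q' \<in> Q \<and> prod_encode q' < prod_encode q \<and>
     (\<exists>c d. c \<le> d \<and> d < length (A q') \<and> A q' ! c = A q ! a \<and> A q' ! d = A q ! b))"

text \<open>For \<open>a = b\<close> the source is \<open>q\<close> itself, so a source always lies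
  in \<open>Q\<close> and the phrases range over a finite set.\<close>

lemma source:
  assumes "q \<in> Q" "a \<le> b" "b < length (A q)" "old q a b"
  shows "source q a b \<in> Q \<and> (a = b \<or> (prod_encode (source q a b) < prod_encode q \<and>
     (\<exists>c d. c \<le> d \<and> d < length (A (source q a b)) \<and> A (source q a b) ! c = A q ! a \<and> A (source q a b) ! d = A q ! b)))"
proof (cases "a = b")
  case True
  then show ?thesis using assms by (simp add: source_def)
next
  case False
  let ?R = "\<lambda>q'. q' \<in> Q \<and> prod_encode q' < prod_encode q \<and>
     (\<exists>c d. c \<le> d \<and> d < length (A q') \<and> A q' ! c = A q ! a \<and> A q' ! d = A q ! b)"
  have "A q ! a \<noteq> A q ! b" using False A_nth_inj[OF assms(1)] assms by auto
  then have "\<exists>q'. ?R q'" using assms(4) unfolding seen_def by auto metis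
  then have "?R (source q a b)" unfolding source_def using False someI_ex[of ?R] by simp
  then show ?thesis by blast
qed

definition tile_phrase :: "(nat \<times> nat) \<times> nat \<Rightarrow> phrase" where
  "tile_phrase = (\<lambda>(q, k). (q, A q ! tau q k, A q ! (tau q (Suc k) - 1), A q ! tau q (Suc k),
     source q (tau q k) (tau q (Suc k) - 1)))"

definition last_phrase :: "nat \<times> nat \<Rightarrow> phrase" where
  "last_phrase q = (q, A q ! tau q (tiles q), A q ! (length (A q) - 1), A q ! (length (A q) - 1),
     source q (tau q (tiles q)) (length (A q) - 1))"

definition code :: "phrase set" where
  "code = tile_phrase ` tile_index \<union> last_phrase ` Q"

lemma phrase_in_range:
  assumes "q \<in> Q" "a \<le> b" "b < length (A q)" "old q a b" "c < length (A q)"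
  shows "(q, A q ! a, A q ! b, A q ! c, source q a b)
    \<in> ({0..<n} \<times> {0..<n}) \<times> {0..<n} \<times> {0..<n} \<times> {0..<n} \<times> ({0..<n} \<times> {0..<n})"
proof -
  have "Q \<subseteq> {0..<n} \<times> {0..<n}" using Q by (auto simp: reach_def)
  then show ?thesis using assms source[OF assms(1-4)] A_nth_less[OF assms(1)] by auto
qed

lemma tile_facts:
  assumes "q \<in> Q" "k < tiles q"
  shows "tau q k \<le> tau q (Suc k) - 1" "tau q (Suc k) - 1 < length (A q)" "tau q (Suc k) < length (A q)"
    "Suc (tau q (Suc k) - 1) = tau q (Suc k)"
  using tau_step(1)[OF assms(2)] tau_less_length[of q "Suc k"] assms by auto

lemma last_facts:
  assumes "q \<in> Q"
  shows "tau q (tiles q) \<le> length (A q) - 1" "length (A q) - 1 < length (A q)"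
  using tau_less_length[OF assms, of "tiles q"] A_ends[OF assms] by auto

lemma code_subset:
  "code \<subseteq> ({0..<n} \<times> {0..<n}) \<times> {0..<n} \<times> {0..<n} \<times> {0..<n} \<times> ({0..<n} \<times> {0..<n})"
proof -
  have "tile_phrase (q, k) \<in> ({0..<n} \<times> {0..<n}) \<times> {0..<n} \<times> {0..<n} \<times> {0..<n} \<times> ({0..<n} \<times> {0..<n})"
    if "q \<in> Q" "k < tiles q" for q k
    unfolding tile_phrase_def case_prod_conv
    by (rule phrase_in_range[OF that(1) tile_facts(1,2)[OF that] tau_step(3)[OF that(2)] tile_facts(3)[OF that]])
  moreover have "last_phrase q \<in> ({0..<n} \<times> {0..<n}) \<times> {0..<n} \<times> {0..<n} \<times> {0..<n} \<times> ({0..<n} \<times> {0..<n})"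
    if "q \<in> Q" for q
    unfolding last_phrase_def by (rule phrase_in_range[OF that last_facts[OF that] tau_end last_facts(2)[OF that]])
  ultimately show ?thesis unfolding code_def tile_index_def by (simp add: image_subset_iff split_beta)
qed

lemma phrase_holdsI:
  assumes "q \<in> Q" "a \<le> b" "b < length (A q)" "old q a b"
    "z = (if Suc b < length (A q) then A q ! Suc b else A q ! b)"
  shows "phrase_holds Q A (q, A q ! a, A q ! b, z, source q a b)"
proof -
  have "A q ! a = A q ! b \<or> (source q a b \<in> Q \<and> (\<exists>c d. c \<le> d \<and> d < length (A (source q a b)) \<and>
      A (source q a b) ! c = A q ! a \<and> A (source q a b) ! d = A q ! b))"
    using source[OF assms(1-4)] by blast
  then show ?thesis unfolding phrase_holds_def using assms by blast
qed

lemma describes_code: "describes code Q A"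
  unfolding describes_def
proof (intro conjI ballI)
  fix q assume q: "q \<in> Q"
  show "A q \<noteq> []" "distinct (A q)" "A q ! 0 = fst q" using A_ends[OF q] A_distinct[OF q] by auto
next
  show "consistent Q A" by (rule A_consistent)
next
  fix x assume "x \<in> code"
  then consider q k where "q \<in> Q" "k < tiles q" "x = tile_phrase (q, k)" | q where "q \<in> Q" "x = last_phrase q"
    by (auto simp: code_def tile_index_def)
  then show "phrase_holds Q A x"
  proof cases
    case 1
    then show ?thesis unfolding 1(3) tile_phrase_def case_prod_conv
      using tile_facts[OF 1(1,2)] by (intro phrase_holdsI[OF _ _ _ tau_step(3)]) auto
  next
    case 2
    then show ?thesis unfolding 2(2) last_phrase_def
      using last_facts[OF 2(1)] by (intro phrase_holdsI[OF _ _ _ tau_end]) auto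
  qed
next
  \<comment> \<open>The processing order serves as the rank.\<close>
  have "parsed code prod_encode Q A q" if q: "q \<in> Q" for q
    unfolding parsed_def
  proof (intro exI conjI allI impI)
    show "tau q 0 = 0" by (rule tau_0)
    show "tau q (tiles q) < length (A q)" by (rule tau_less_length[OF q order_refl])
    have "last_phrase q \<in> code" using q by (simp add: code_def)
    then show "copied code prod_encode Q A q (tau q (tiles q)) (length (A q) - 1) (A q ! (length (A q) - 1))"
      unfolding copied_def last_phrase_def using source[OF q last_facts[OF q] tau_end] by blast
    fix k assume k: "k < tiles q"
    show "tau q k < tau q (Suc k)" by (rule tau_step(1)[OF k])
    show "tau q (Suc k) < length (A q)" by (rule tile_facts(3)[OF q k])
    have "tile_phrase (q, k) \<in> code" using q k by (simp add: code_def tile_index_def)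
    then show "copied code prod_encode Q A q (tau q k) (tau q (Suc k) - 1) (A q ! tau q (Suc k))"
      unfolding copied_def tile_phrase_def case_prod_conv using source[OF q tile_facts(1,2)[OF q k] tau_step(3)[OF k]] by blast
  qed
  then show "\<exists>rank. \<forall>q\<in>Q. parsed code rank Q A q" by blast
qed

lemma card_code_le:
  assumes "finite Q"
  shows "card code \<le> card tile_index + card Q"
proof -
  have "finite tile_index" using assms by (simp add: tile_index_def)
  then have "card (tile_phrase ` tile_index) \<le> card tile_index" "card (last_phrase ` Q) \<le> card Q"
    using assms by (auto intro: card_image_le)
  then show ?thesis unfolding code_def using card_Un_le[of "tile_phrase ` tile_index" "last_phrase ` Q"] by linarith
qed

end

section \<open>The two bounds\<close>

lemma card_bounded_subsets_le:
  assumes "finite U"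
  shows "finite {X. X \<subseteq> U \<and> card X \<le> L}" "card {X. X \<subseteq> U \<and> card X \<le> L} \<le> (card U + 1) ^ L"
proof -
  \<comment> \<open>A set of at most \<open>L\<close> elements becomes a list of length exactly
    \<open>L\<close>, padded with \<open>None\<close>.\<close>
  let ?S = "insert None (Some ` U)"
  let ?B = "{xs. set xs \<subseteq> ?S \<and> length xs = L}"
  have finB: "finite ?B" using assms by (intro finite_lists_length_eq) simp
  have sub: "{X. X \<subseteq> U \<and> card X \<le> L} \<subseteq> (\<lambda>xs. {x. Some x \<in> set xs}) ` ?B"
  proof
    fix X assume "X \<in> {X. X \<subseteq> U \<and> card X \<le> L}"
    then have X: "X \<subseteq> U" "card X \<le> L" by auto
    obtain ys where ys: "set ys = X" "distinct ys" using finite_distinct_list[OF finite_subset[OF X(1) assms]] by blast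
    have len: "length ys = card X" using distinct_card[OF ys(2)] ys(1) by simp
    let ?xs = "map Some ys @ replicate (L - card X) None"
    have "?xs \<in> ?B" using X ys(1) len by auto
    moreover have "X = {x. Some x \<in> set ?xs}" using ys(1) by auto
    ultimately show "X \<in> (\<lambda>xs. {x. Some x \<in> set xs}) ` ?B" by blast
  qed
  then show "finite {X. X \<subseteq> U \<and> card X \<le> L}" using finB by (meson finite_imageI finite_subset)
  have "card {X. X \<subseteq> U \<and> card X \<le> L} \<le> card ?B" using sub by (rule surj_card_le[OF finB])
  also have "\<dots> = card ?S ^ L" using assms by (intro card_lists_length_eq) simp
  also have "card ?S = card U + 1" using assms by (subst card_insert_disjoint) (auto simp: card_image)
  finally show "card {X. X \<subseteq> U \<and> card X \<le> L} \<le> (card U + 1) ^ L" .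
qed

text \<open>A code is a set of at most \<open>M + p\<close> phrases. There are few enough such sets
  to number them by bit strings, and a code determines the reported paths.\<close>

lemma spo_exists:
  assumes M: "\<And>E w P. wgraph n E w \<Longrightarrow> P \<subseteq> {0..<n} \<times> {0..<n} \<Longrightarrow> card P = p \<Longrightarrow> \<exists>H. dist_preserver E w P H \<and> card H \<le> M"
    and g: "n \<le> 2 ^ g" "1 \<le> g"
  shows "\<exists>D. \<forall>E w P. wgraph n E w \<and> P \<subseteq> {0..<n} \<times> {0..<n} \<and> card P = p \<longrightarrow>
    (\<exists>b. length b \<le> 8 * g * (M + p) \<and> is_spo D b E w P)"
proof -
  let ?V = "{0..<n}"
  let ?U = "(?V \<times> ?V) \<times> ?V \<times> ?V \<times> ?V \<times> (?V \<times> ?V)"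
  let ?K = "8 * g * (M + p)"
  let ?X = "{X :: phrase set. X \<subseteq> ?U \<and> card X \<le> M + p}"
  let ?B = "{b :: bool list. set b \<subseteq> UNIV \<and> length b = ?K}"
  \<comment> \<open>A phrase consists of 2 + 1 + 1 + 1 + 2 vertices.\<close>
  have cU: "card ?U = n ^ 7" by (simp add: card_cartesian_product numeral_eq_Suc algebra_simps)
  \<comment> \<open>The summand 1 is the padding symbol; the eighth factor \<open>2 ^ g\<close>
    absorbs it.\<close>
  have "n ^ 7 + 1 \<le> (2::nat) ^ (8 * g)"
  proof -
    have "n ^ 7 \<le> (2 ^ g) ^ 7" using g(1) by (rule power_mono) simp
    also have "\<dots> = 2 ^ (7 * g)" by (simp add: power_mult[symmetric] mult.commute)
    finally have 1: "n ^ 7 \<le> 2 ^ (7 * g)" .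
    have "(2::nat) ^ (7 * g) + 2 ^ (7 * g) = 2 ^ Suc (7 * g)" by simp
    also have "\<dots> \<le> 2 ^ (8 * g)" using g(2) by (intro power_increasing) auto
    finally show ?thesis using 1 one_le_power[of "2::nat" "7 * g"] by linarith
  qed
  then have "(card ?U + 1) ^ (M + p) \<le> (2 ^ (8 * g)) ^ (M + p)" unfolding cU by (rule power_mono) simp
  also have "\<dots> = 2 ^ ?K" by (simp add: power_mult)
  also have "2 ^ ?K = card ?B" by (subst card_lists_length_eq) auto
  finally have "(card ?U + 1) ^ (M + p) \<le> card ?B" .
  note le = this
  have finU: "finite ?U" by simp
  have cX: "card ?X \<le> card ?B" by (rule order_trans[OF card_bounded_subsets_le(2)[OF finU] le])
  have finX: "finite ?X" by (rule card_bounded_subsets_le(1)[OF finU])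
  have finB: "finite ?B" by (rule finite_lists_length_eq) simp
  obtain f where f: "f ` ?X \<subseteq> ?B" "inj_on f ?X" using card_le_inj[OF finX finB cX] by blast
  define sys :: "phrase set \<Rightarrow> (nat \<times> nat) set \<times> (nat \<times> nat \<Rightarrow> nat list)" where
    "sys = (\<lambda>X. SOME (Q, A). describes X Q A)"
  \<comment> \<open>The decoder depends on neither graph nor demands: it chooses some system
    described by the code, which \<open>describes_determines\<close> will identify.\<close>
  define D where "D = (\<lambda>b q. let (Q, A) = sys (inv_into ?X f b) in if q \<in> Q then Some (A q) else None)"
  have "\<exists>b. length b \<le> ?K \<and> is_spo D b E w P"
    if G: "wgraph n E w" and P: "P \<subseteq> ?V \<times> ?V" and cP: "card P = p" for E w P
  proof -
    obtain w' where w': "unique_shortest n E w'"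
      "\<And>s t \<pi>. s < n \<Longrightarrow> shortest E w' s t \<pi> \<Longrightarrow> shortest E w s t \<pi>"
      using unique_shortest_perturbation[OF G] by blast
    interpret U: unique_shortest n E w' by (rule w'(1))
    \<comment> \<open>Only connected demand pairs are encoded; absence from the decoded domain means
      that there is no path.\<close>
    interpret U: demand_paths n E w' "P \<inter> U.reach" by unfold_locales simp
    have finP: "finite P" by (rule finite_subset[OF P]) simp
    have cQ: "card (P \<inter> U.reach) \<le> p" using card_mono[OF finP, of "P \<inter> U.reach"] cP by simp
    have pn: "p \<le> card (?V \<times> ?V)" using card_mono[of "?V \<times> ?V" P] P cP by simp
    have tl: "card U.tile_index \<le> M"
      by (rule U.tile_count_le[OF _ cQ pn]) (simp add: finP, rule M)
    have "card U.code \<le> card U.tile_index + card (P \<inter> U.reach)" by (rule U.card_code_le) (simp add: finP)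
    then have X: "U.code \<in> ?X" using tl cQ U.code_subset by simp
    define b where "b = f U.code"
    have "b \<in> ?B" unfolding b_def by (rule subsetD[OF f(1) imageI[OF X]])
    then have b: "length b \<le> ?K" by simp
    have inv: "inv_into ?X f b = U.code" unfolding b_def by (rule inv_into_f_f[OF f(2) X])
    obtain Q A where QA: "sys U.code = (Q, A)" by (cases "sys U.code")
    have "case sys U.code of (Q, A) \<Rightarrow> describes U.code Q A"
      unfolding sys_def by (rule someI[of "\<lambda>(Q, A). describes U.code Q A" "(P \<inter> U.reach, U.A)"]) (simp add: U.describes_code)
    then have "describes U.code Q A" using QA by simp
    from describes_determines[OF U.describes_code this]
    have Q: "Q = P \<inter> U.reach" and A: "\<And>q. q \<in> Q \<Longrightarrow> A q = U.A q" by auto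
    have D: "D b q = (if q \<in> Q then Some (U.A q) else None)" for q
      unfolding D_def inv QA using A by simp
    have "is_spo D b E w P"
      unfolding is_spo_def
    proof (clarify)
      fix s t assume st: "(s, t) \<in> P"
      then have stn: "s < n" "t < n" using P by auto
      show "case D b (s, t) of None \<Rightarrow> \<nexists>\<pi>. is_path E s t \<pi>
        | Some \<pi> \<Rightarrow> is_path E s t \<pi> \<and> ereal (path_weight w \<pi>) = gdist E w s t"
      proof (cases "(s, t) \<in> Q")
        case True
        then have "shortest E w' s t (U.A (s, t))" using U.A_shortest[of "(s, t)"] Q by simp
        then have "shortest E w s t (U.A (s, t))" by (rule w'(2)[OF stn(1)])
        then show ?thesis using True D by (simp add: shortest_iff_gdist)
      next
        case False
        then show ?thesis using D Q st stn by (simp add: U.reach_def)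
      qed
    qed
    then show ?thesis using b by blast
  qed
  then show ?thesis by blast
qed

section \<open>Attained minima and their comparison\<close>

lemma DP_spec:
  assumes "wgraph n E w" "P \<subseteq> {0..<n} \<times> {0..<n}" "card P = p"
  shows "\<exists>H. dist_preserver E w P H \<and> card H \<le> DP n p"
proof -
  let ?R = "\<lambda>k. \<forall>E w P. wgraph n E w \<and> P \<subseteq> {0..<n} \<times> {0..<n} \<and> card P = p \<longrightarrow>
       (\<exists>H. dist_preserver E w P H \<and> card H \<le> k)"
  \<comment> \<open>The whole graph preserves all distances, so the set of admissible bounds is
    nonempty.\<close>
  have "?R (card ({0..<n} \<times> {0..<n}))"
  proof (intro allI impI)
    fix E w P assume "wgraph n E w \<and> P \<subseteq> {0..<n} \<times> {0..<n} \<and> card P = p"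
    then have "card E \<le> card ({0..<n} \<times> {0..<n})" by (intro card_mono) (auto simp: wgraph_def)
    then show "\<exists>H. dist_preserver E w P H \<and> card H \<le> card ({0..<n} \<times> {0..<n})"
      by (intro exI[of _ E]) (auto simp: dist_preserver_def)
  qed
  then have "?R (DP n p)" unfolding DP_def by (rule LeastI)
  then show ?thesis using assms by blast
qed

lemma DP_witness:
  assumes "DP n p \<noteq> 0"
  shows "\<exists>E w P. wgraph n E w \<and> P \<subseteq> {0..<n} \<times> {0..<n} \<and> card P = p \<and>
    (\<forall>H. dist_preserver E w P H \<longrightarrow> DP n p \<le> card H)"
proof -
  let ?R = "\<lambda>k. \<forall>E w P. wgraph n E w \<and> P \<subseteq> {0..<n} \<times> {0..<n} \<and> card P = p \<longrightarrow>
       (\<exists>H. dist_preserver E w P H \<and> card H \<le> k)"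
  have "\<not> ?R (DP n p - 1)" unfolding DP_def by (rule not_less_Least) (use assms in \<open>simp add: DP_def\<close>)
  then obtain E w P where *: "wgraph n E w" "P \<subseteq> {0..<n} \<times> {0..<n}" "card P = p"
    "\<And>H. dist_preserver E w P H \<Longrightarrow> \<not> card H \<le> DP n p - 1" by blast
  have "DP n p \<le> card H" if "dist_preserver E w P H" for H using *(4)[OF that] by linarith
  then show ?thesis using *(1-3) by blast
qed

lemma unit_weight_gdist_1:
  assumes "gdist H (\<lambda>_. 1) s t \<le> 1" "s \<noteq> t"
  shows "(s, t) \<in> H"
proof (rule ccontr)
  assume no: "(s, t) \<notin> H"
  have "2 \<le> gdist H (\<lambda>_. 1) s t"
  proof (rule gdist_ge)
    fix \<pi> assume \<pi>: "is_path H s t \<pi>"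
    have "path_weight (\<lambda>_. 1) \<pi> = real (length \<pi> - 1)" by (simp add: path_weight_def)
    moreover have "2 \<le> length \<pi> - 1"
    proof (rule ccontr)
      assume "\<not> 2 \<le> length \<pi> - 1"
      then obtain x y where "\<pi> = [] \<or> \<pi> = [x] \<or> \<pi> = [x, y]"
        by (cases \<pi> rule: path_edges.cases) (auto simp: Suc_le_eq not_less)
      then show False using \<pi> no assms(2) by auto
    qed
    ultimately show "2 \<le> ereal (path_weight (\<lambda>_. 1) \<pi>)" by simp
  qed
  then have "(2::ereal) \<le> 1" using assms(1) by (rule order_trans)
  then show False by simp
qed

text \<open>Absorbs the summand \<open>p\<close> of the upper bound. In a unit-weight graph whose
  edges are all demanded, every edge that is not a loop is forced.\<close>

lemma demands_le_DP:
  assumes "2 \<le> n" "p \<le> n * n"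
  shows "p \<le> 2 * DP n p"
proof -
  let ?V = "{0..<n}"
  let ?N = "?V \<times> ?V - Id"
  have cV: "card (?V \<times> ?V) = n * n" by simp
  have "?N = ?V \<times> ?V - (\<lambda>v. (v, v)) ` ?V" by auto
  then have cN: "card ?N = n * n - n"
    using card_Diff_subset[of "(\<lambda>v. (v, v)) ` ?V" "?V \<times> ?V"] by (simp add: card_image inj_on_def image_subset_iff)
  \<comment> \<open>Loops are never forced. For \<open>2 \<le> n\<close> they are at most half of
    all pairs, so \<open>q\<close> is at least half of \<open>p\<close>.\<close>
  define q where "q = min p (n * n - n)"
  obtain E where E: "E \<subseteq> ?N" "card E = q" "finite E"
    using obtain_subset_with_card_n[of q ?N] cN q_def by auto
  obtain P where P: "E \<subseteq> P" "P \<subseteq> ?V \<times> ?V" "card P = p"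
    using exists_subset_between[of E p "?V \<times> ?V"] E cV assms(2) q_def by auto
  have G: "wgraph n E (\<lambda>_. 1)" using E(1) by (auto simp: wgraph_def)
  obtain H where H: "dist_preserver E (\<lambda>_. 1) P H" "card H \<le> DP n p" using DP_spec[OF G P(2,3)] by blast
  have "E \<subseteq> H"
  proof (rule subrelI)
    fix s t assume st: "(s, t) \<in> E"
    then have "gdist E (\<lambda>_. 1) s t \<le> 1" using gdist_le[of E s t "[s, t]" "\<lambda>_. 1"] by (simp add: one_ereal_def)
    moreover have "gdist H (\<lambda>_. 1) s t = gdist E (\<lambda>_. 1) s t"
      using H(1) st P(1) by (auto simp: dist_preserver_def)
    ultimately show "(s, t) \<in> H" using unit_weight_gdist_1[of H s t] E(1) st by auto
  qed
  then have "q \<le> DP n p" using H E card_mono[of H E] finite_subset[of H E] by (auto simp: dist_preserver_def)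
  moreover have "p \<le> 2 * q"
  proof -
    have "2 * n \<le> n * n" using assms(1) by simp
    then show ?thesis using assms(2) unfolding q_def by linarith
  qed
  ultimately show ?thesis by linarith
qed

text \<open>Any finite bound makes the least value meaningful; the crude choice
  \<open>g = Suc n\<close> provides one.\<close>

lemma SPO_spec:
  "\<exists>D. \<forall>E w P. wgraph n E w \<and> P \<subseteq> {0..<n} \<times> {0..<n} \<and> card P = p \<longrightarrow>
       (\<exists>b. length b \<le> SPO n p \<and> is_spo D b E w P)"
proof -
  let ?R = "\<lambda>k. \<exists>D. \<forall>E w P. wgraph n E w \<and> P \<subseteq> {0..<n} \<times> {0..<n} \<and> card P = p \<longrightarrow>
       (\<exists>b. length b \<le> k \<and> is_spo D b E w P)"
  have "n \<le> 2 ^ Suc n" by (rule less_imp_le[OF less_trans[OF less_exp]]) simp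
  from spo_exists[OF DP_spec this] have "?R (8 * Suc n * (DP n p + p))" by simp
  then show "?R (SPO n p)" unfolding SPO_def by (rule LeastI)
qed

lemma DP_le_SPO: "DP n p \<le> 4 * SPO n p"
proof (cases "DP n p = 0")
  case False
  obtain E w P where *: "wgraph n E w" "P \<subseteq> {0..<n} \<times> {0..<n}" "card P = p"
    "\<And>H. dist_preserver E w P H \<Longrightarrow> DP n p \<le> card H" using DP_witness[OF False] by blast
  obtain D where D: "\<And>E w P. wgraph n E w \<and> P \<subseteq> {0..<n} \<times> {0..<n} \<and> card P = p \<Longrightarrow>
       \<exists>b. length b \<le> SPO n p \<and> is_spo D b E w P" using SPO_spec by blast
  show ?thesis by (rule spo_size_ge_dist_preserver[OF *(1,2,4)]) (use D *(2,3) in auto)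
qed simp

lemma SPO_le:
  assumes "\<forall>E w P. wgraph n E w \<and> P \<subseteq> {0..<n} \<times> {0..<n} \<and> card P = p \<longrightarrow>
       (\<exists>b. length b \<le> k \<and> is_spo D b E w P)"
  shows "SPO n p \<le> k"
  unfolding SPO_def by (rule Least_le) (use assms in blast)

lemma SPO_le_DP_log:
  assumes "1 \<le> n"
  shows "real (SPO n p) \<le> 48 * real (DP n p) * log 2 (real n)"
proof (cases "n = 1")
  case True
  \<comment> \<open>The logarithm vanishes for \<open>n = 1\<close>, so no bits may be used; the
    one-vertex walk is always a correct answer.\<close>
  have "SPO n p \<le> 0"
  proof (rule SPO_le[of _ _ _ "\<lambda>_ _. Some [0]"], intro allI impI)
    fix E w P assume *: "wgraph n E w \<and> P \<subseteq> {0..<n} \<times> {0..<n} \<and> card P = p"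
    have "shortest E w 0 0 [0]"
      unfolding shortest_def using path_weight_nonneg[of E 0 0 _ w] * by (auto simp: wgraph_def)
    moreover have "s = 0 \<and> t = 0" if "(s, t) \<in> P" for s t using that * True by auto
    ultimately have "is_spo (\<lambda>_ _. Some [0]) [] E w P" unfolding is_spo_def by (auto simp: shortest_iff_gdist)
    then show "\<exists>b. length b \<le> 0 \<and> is_spo (\<lambda>_ _. Some [0]) b E w P" by (intro exI[of _ "[]"]) simp
  qed
  then show ?thesis using True by simp
next
  case False
  then have n: "2 \<le> n" using assms by simp
  have log1: "1 \<le> log 2 (real n)" using n by (simp add: le_log_iff)
  show ?thesis
  proof (cases "p \<le> n * n")
    case True
    define g where "g = nat \<lceil>log 2 (real n)\<rceil>"
    have g: "log 2 (real n) \<le> real g" "real g \<le> log 2 (real n) + 1" unfolding g_def using log1 by linarith+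
    have "real n \<le> 2 powr real g" using g(1) n by (simp add: log_le_iff)
    then have ng: "n \<le> 2 ^ g" by (simp add: powr_realpow)
    have g1: "1 \<le> g" using g(1) log1 by linarith
    obtain D where "\<forall>E w P. wgraph n E w \<and> P \<subseteq> {0..<n} \<times> {0..<n} \<and> card P = p \<longrightarrow>
       (\<exists>b. length b \<le> 8 * g * (DP n p + p) \<and> is_spo D b E w P)"
      using spo_exists[OF DP_spec ng g1] by blast
    then have "SPO n p \<le> 8 * g * (DP n p + p)" by (rule SPO_le)
    also have "\<dots> \<le> 8 * g * (3 * DP n p)" using demands_le_DP[OF n True] by simp
    finally have "real (SPO n p) \<le> real (8 * g * (3 * DP n p))" by (simp only: of_nat_le_iff)
    also have "\<dots> = real g * (24 * real (DP n p))" by simp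
    \<comment> \<open>Rounding up at most doubles the logarithm, as it is at least 1. The constant
      48 is 8 * 3 * 2.\<close>
    also have "\<dots> \<le> (2 * log 2 (real n)) * (24 * real (DP n p))"
      using g(2) log1 by (intro mult_right_mono) auto
    finally show ?thesis by (simp add: mult_ac)
  next
    case False
    \<comment> \<open>With more demands than pairs of vertices there is no instance, and the empty
      string suffices vacuously.\<close>
    have "card P \<noteq> p" if "P \<subseteq> {0..<n} \<times> {0..<n}" for P
      using card_mono[OF _ that] False by simp
    then have "SPO n p \<le> 0" by (intro SPO_le[of _ _ _ "\<lambda>_ _. None"]) auto
    then show ?thesis using log1 by simp
  qed
qed

theorem theorem4p7:
  shows "\<exists>c C :: real. c > 0 \<and> C > 0 \<and>
    (\<forall>n p :: nat. n \<ge> 1 \<longrightarrow> p \<ge> 1 \<longrightarrow>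
       c * real (DP n p) \<le> real (SPO n p) \<and>
       real (SPO n p) \<le> C * real (DP n p) * log 2 (real n))"
proof (rule exI[of _ "1 / 4"], rule exI[of _ 48], intro conjI allI impI)
  fix n p :: nat assume "1 \<le> n"
  then show "real (SPO n p) \<le> 48 * real (DP n p) * log 2 (real n)" by (rule SPO_le_DP_log)
  have "real (DP n p) \<le> real (4 * SPO n p)" using DP_le_SPO[of n p] by (simp only: of_nat_le_iff)
  then show "1 / 4 * real (DP n p) \<le> real (SPO n p)" by simp
qed auto

end
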